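(* Let $\Phi=\{\phi_{i,j}\}_{1\le i\le 3,\,1\le j\le 2}$ be a collection of functions $\phi_{i,j}\in C^\infty(\mathbb{R})$ such that $\phi_{i,1}'\phi_{i,2}'=1$ for $1\le i\le 3$, and let $\mathcal{M}_\Phi=(\mathbb{R}^{14},g_\Phi)$ be the pseudo-Riemannian manifold defined in the context. Then: (1) $\mathcal{M}_\Phi$ is geodesically complete. (2) For all $P\in\mathbb{R}^{14}$, $\exp_P$ is a diffeomorphism from $T_P(\mathbb{R}^{14})$ to $\mathbb{R}^{14}$. (3) $\mathcal{M}_\Phi$ has $0$-model $\mathfrak{M}_{14}$; that is, for every $P\in\mathbb{R}^{14}$ there is a linear isomorphism $\Theta_P:T_P(\mathbb{R}^{14})\to\mathbb{R}^{14}$ with $\Theta_P^*\langle\cdot,\cdot\rangle=(g_\Phi)_P$ and $\Theta_P^*A=R_P$, where $\langle\cdot,\cdot\rangle$ and $A$ are the inner product and curvature tensor of $\mathfrak{M}_{14}$. (4) $\mathcal{M}_\Phi$ is Jacobi--Tsankov but $\mathcal{M}_\Phi$ is not $2$-step Jacobi nilpotent.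
   Context: Conventions: for a pseudo-Riemannian manifold $(M,g)$ with Levi-Civita connection $\nabla$, $\mathcal{R}(X,Y)=\nabla_X\nabla_Y-\nabla_Y\nabla_X-\nabla_{[X,Y]}$, $R(X,Y,Z,W)=g(\mathcal{R}(X,Y)Z,W)$, $\mathcal{J}(x)y=\mathcal{R}(y,x)x$. The manifold is Jacobi--Tsankov if $\mathcal{J}(x)\mathcal{J}(y)=\mathcal{J}(y)\mathcal{J}(x)$ for all tangent vectors $x,y$ at each point, and $2$-step Jacobi nilpotent if $\mathcal{J}(x)\mathcal{J}(y)=0$ for all such $x,y$. The metric $g_\Phi$: let $\{x_i,x_i^*,y_{i,1},y_{i,2},y_{4,1},y_{4,2}\}$, $1\le i\le3$, be coordinates on $\mathbb{R}^{14}$. The non-zero components of $g_\Phi$ are, up to symmetry: $g_\Phi(\partial_{x_i},\partial_{x_i^*})=g_\Phi(\partial_{y_{i,1}},\partial_{y_{i,2}})=1$ for $1\le i\le3$; $g_\Phi(\partial_{y_{4,1}},\partial_{y_{4,1}})=g_\Phi(\partial_{y_{4,2}},\partial_{y_{4,2}})=-\frac12$, $g_\Phi(\partial_{y_{4,1}},\partial_{y_{4,2}})=\frac14$; $g_\Phi(\partial_{x_1},\partial_{x_1})=-2\phi_{2,1}(x_2)y_{2,1}-2\phi_{3,1}(x_3)y_{3,1}$; $g_\Phi(\partial_{x_2},\partial_{x_2})=-2\phi_{3,2}(x_3)y_{3,2}-2\phi_{1,2}(x_1)y_{1,2}$; $g_\Phi(\partial_{x_3},\partial_{x_3})=-2\phi_{1,1}(x_1)y_{1,1}-2\phi_{2,2}(x_2)y_{2,2}$;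 $g_\Phi(\partial_{x_2},\partial_{x_3})=x_1y_{4,1}$; $g_\Phi(\partial_{x_1},\partial_{x_3})=x_2y_{4,2}$. The model $\mathfrak{M}_{14}=(\mathbb{R}^{14},\langle\cdot,\cdot\rangle,A)$: $\mathbb{R}^{14}$ has basis $\{\alpha_i,\alpha_i^*,\beta_{i,1},\beta_{i,2},\beta_{4,1},\beta_{4,2}\}$, $1\le i\le 3$, and the non-zero components of the symmetric inner product $\langle\cdot,\cdot\rangle$ and of the algebraic curvature tensor $A$ (a $4$-tensor with the symmetries of the Riemann curvature tensor) are, up to the usual symmetries: $\langle\alpha_i,\alpha_i^*\rangle=\langle\beta_{i,1},\beta_{i,2}\rangle=1$ for $1\le i\le3$; $\langle\beta_{4,1},\beta_{4,1}\rangle=\langle\beta_{4,2},\beta_{4,2}\rangle=-\frac12$; $\langle\beta_{4,1},\beta_{4,2}\rangle=\frac14$; $A(\alpha_2,\alpha_1,\alpha_1,\beta_{2,1})=A(\alpha_3,\alpha_1,\alpha_1,\beta_{3,1})=1$; $A(\alpha_3,\alpha_2,\alpha_2,\beta_{3,2})=A(\alpha_1,\alpha_2,\alpha_2,\beta_{1,2})=1$; $A(\alpha_1,\alpha_3,\alpha_3,\beta_{1,1})=A(\alpha_2,\alpha_3,\alpha_3,\beta_{2,2})=1$; $A(\alpha_1,\alpha_2,\alpha_3,\beta_{4,1})=A(\alpha_1,\alpha_3,\alpha_2,\beta_{4,1})=-\frac12$; $A(\alpha_2,\alpha_3,\alpha_1,\beta_{4,2})=A(\alpha_2,\alpha_1,\alpha_3,\beta_{4,2})=-\frac12$.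 *)

theory Defs
  imports "HOL-Analysis.Analysis"
begin

section \<open>Smooth maps between Euclidean spaces\<close>

primrec C_k :: "nat \<Rightarrow> ('a::euclidean_space \<Rightarrow> 'b::euclidean_space) \<Rightarrow> bool" where
  "C_k 0 f \<longleftrightarrow> continuous_on UNIV f"
| "C_k (Suc k) f \<longleftrightarrow> (\<forall>x. f differentiable (at x))
     \<and> (\<forall>v. C_k k (\<lambda>x. frechet_derivative f (at x) v))"

definition smooth :: "('a::euclidean_space \<Rightarrow> 'b::euclidean_space) \<Rightarrow> bool" where
  "smooth f \<longleftrightarrow> (\<forall>k. C_k k f)"

definition diffeomorphism :: "('a::euclidean_space \<Rightarrow> 'b::euclidean_space) \<Rightarrow> bool" where
  "diffeomorphism f \<longleftrightarrow> bij f \<and> smooth f \<and> smooth (inv f)"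


section \<open>Pseudo-Riemannian geometry of a metric on coordinate space\<close>

text \<open>
  A metric on the manifold \<open>real^'n\<close> is given by its component matrices
  \<open>g p $ i $ j\<close> with respect to the global coordinate frame. Every tangent space is identified
  with \<open>real^'n\<close> through this frame, so a vector field is a function \<open>real^'n \<Rightarrow> real^'n\<close>.
  The definitions are meaningful for smooth \<open>g\<close> with symmetric invertible values.
\<close>

type_synonym 'n metric_field = "real^'n \<Rightarrow> real^'n^'n"

definition metric_at :: "'n::finite metric_field \<Rightarrow> real^'n \<Rightarrow> real^'n \<Rightarrow> real^'n \<Rightarrow> real" where
  "metric_at g p u v = (\<Sum>i\<in>UNIV. \<Sum>j\<in>UNIV. g p $ i $ j * u $ i * v $ j)"

definition partial_deriv :: "'n::finite \<Rightarrow> (real^'n \<Rightarrow> real) \<Rightarrow> real^'n \<Rightarrow> real" where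
  "partial_deriv i f p = frechet_derivative f (at p) (axis i 1)"

text \<open>\<open>christoffel g p k i j\<close> is the symbol with upper index \<open>k\<close> and lower indices \<open>i\<close>, \<open>j\<close>.\<close>

definition christoffel :: "'n::finite metric_field \<Rightarrow> real^'n \<Rightarrow> 'n \<Rightarrow> 'n \<Rightarrow> 'n \<Rightarrow> real" where
  "christoffel g p k i j = (1/2) * (\<Sum>l\<in>UNIV. matrix_inv (g p) $ k $ l *
     (partial_deriv i (\<lambda>q. g q $ j $ l) p + partial_deriv j (\<lambda>q. g q $ i $ l) p
      - partial_deriv l (\<lambda>q. g q $ i $ j) p))"

definition christoffel_form :: "'n::finite metric_field \<Rightarrow> real^'n \<Rightarrow> real^'n \<Rightarrow> real^'n \<Rightarrow> real^'n" where
  "christoffel_form g p u v = (\<chi> k. \<Sum>i\<in>UNIV. \<Sum>j\<in>UNIV. christoffel g p k i j * u $ i * v $ j)"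

text \<open>The Levi-Civita connection.\<close>

definition nabla ::
  "'n::finite metric_field \<Rightarrow> (real^'n \<Rightarrow> real^'n) \<Rightarrow> (real^'n \<Rightarrow> real^'n) \<Rightarrow> real^'n \<Rightarrow> real^'n" where
  "nabla g U V p = frechet_derivative V (at p) (U p) + christoffel_form g p (U p) (V p)"

text \<open>The two characterizing properties of the Levi-Civita connection, in coordinates.\<close>

lemma christoffel_torsion_free:
  assumes "\<And>q i j. g q $ i $ j = g q $ j $ i"
  shows "christoffel g p k i j = christoffel g p k j i"
proof -
  have "(\<lambda>q. g q $ i $ j) = (\<lambda>q. g q $ j $ i)" using assms by auto
  then show ?thesis by (simp add: christoffel_def algebra_simps)
qed

lemma christoffel_metric:
  fixes g :: "'n::finite metric_field"
  assumes sym: "\<And>q i j. g q $ i $ j = g q $ j $ i" and inv: "invertible (g p)"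
  shows "partial_deriv k (\<lambda>q. g q $ i $ j) p =
    (\<Sum>m\<in>UNIV. christoffel g p m k i * g p $ m $ j + christoffel g p m k j * g p $ i $ m)"
proof -
  have right: "g p ** matrix_inv (g p) = mat 1"
    using someI_ex[OF inv[unfolded invertible_def]] by (simp add: matrix_inv_def)
  define G where "G a b l = partial_deriv a (\<lambda>q. g q $ b $ l) p + partial_deriv b (\<lambda>q. g q $ a $ l) p
      - partial_deriv l (\<lambda>q. g q $ a $ b) p" for a b l
  have lower: "(\<Sum>m\<in>UNIV. g p $ c $ m * christoffel g p m a b) = (1/2) * G a b c" for a b c
  proof -
    have "christoffel g p m a b = (1/2) * (matrix_inv (g p) *v (\<chi> l. G a b l)) $ m" for m
      by (simp add: christoffel_def G_def matrix_vector_mult_def)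
    then have "(\<Sum>m\<in>UNIV. g p $ c $ m * christoffel g p m a b)
        = (\<Sum>m\<in>UNIV. (1/2) * (g p $ c $ m * (matrix_inv (g p) *v (\<chi> l. G a b l)) $ m))"
      by (intro sum.cong refl) (simp only: mult.left_commute)
    also have "\<dots> = (1/2) * (g p *v (matrix_inv (g p) *v (\<chi> l. G a b l))) $ c"
      by (simp only: sum_distrib_left matrix_vector_mult_def[of "g p"] vec_lambda_beta)
    also have "g p *v (matrix_inv (g p) *v (\<chi> l. G a b l)) = (\<chi> l. G a b l)"
      by (simp add: matrix_vector_mul_assoc right)
    finally show ?thesis by simp
  qed
  have s: "(\<lambda>q. g q $ a $ b) = (\<lambda>q. g q $ b $ a)" for a b using sym by auto
  have "(\<Sum>m\<in>UNIV. christoffel g p m k i * g p $ m $ j + christoffel g p m k j * g p $ i $ m)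
      = (\<Sum>m\<in>UNIV. g p $ j $ m * christoffel g p m k i) + (\<Sum>m\<in>UNIV. g p $ i $ m * christoffel g p m k j)"
    by (simp add: sum.distrib mult.commute sym[of p _ j])
  also have "\<dots> = (1/2) * (G k i j + G k j i)" by (simp add: lower)
  also have "\<dots> = partial_deriv k (\<lambda>q. g q $ i $ j) p"
    by (simp add: G_def s[of j i] s[of j k] s[of i k])
  finally show ?thesis by simp
qed

definition lie_bracket ::
  "(real^'n::finite \<Rightarrow> real^'n) \<Rightarrow> (real^'n \<Rightarrow> real^'n) \<Rightarrow> real^'n \<Rightarrow> real^'n" where
  "lie_bracket U V p = frechet_derivative V (at p) (U p) - frechet_derivative U (at p) (V p)"

definition curvature_field ::
  "'n::finite metric_field \<Rightarrow> (real^'n \<Rightarrow> real^'n) \<Rightarrow> (real^'n \<Rightarrow> real^'n) \<Rightarrow> (real^'n \<Rightarrow> real^'n)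
     \<Rightarrow> real^'n \<Rightarrow> real^'n" where
  "curvature_field g U V W p =
     nabla g U (nabla g V W) p - nabla g V (nabla g U W) p - nabla g (lie_bracket U V) W p"

text \<open>
  The value of the curvature field at \<open>p\<close> depends only on the values of the three vector fields
  at \<open>p\<close>; tangent vectors are extended here to constant-coefficient fields.
\<close>

definition curv_op :: "'n::finite metric_field \<Rightarrow> real^'n \<Rightarrow> real^'n \<Rightarrow> real^'n \<Rightarrow> real^'n \<Rightarrow> real^'n" where
  "curv_op g p x y z = curvature_field g (\<lambda>_. x) (\<lambda>_. y) (\<lambda>_. z) p"

definition curv_tensor ::
  "'n::finite metric_field \<Rightarrow> real^'n \<Rightarrow> real^'n \<Rightarrow> real^'n \<Rightarrow> real^'n \<Rightarrow> real^'n \<Rightarrow> real" where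
  "curv_tensor g p x y z w = metric_at g p (curv_op g p x y z) w"

definition jacobi :: "'n::finite metric_field \<Rightarrow> real^'n \<Rightarrow> real^'n \<Rightarrow> real^'n \<Rightarrow> real^'n" where
  "jacobi g p x y = curv_op g p y x x"

definition jacobi_tsankov :: "'n::finite metric_field \<Rightarrow> bool" where
  "jacobi_tsankov g \<longleftrightarrow> (\<forall>p x y. jacobi g p x \<circ> jacobi g p y = jacobi g p y \<circ> jacobi g p x)"

definition two_step_jacobi_nilpotent :: "'n::finite metric_field \<Rightarrow> bool" where
  "two_step_jacobi_nilpotent g \<longleftrightarrow> (\<forall>p x y. jacobi g p x \<circ> jacobi g p y = (\<lambda>_. 0))"

definition geodesic_on :: "'n::finite metric_field \<Rightarrow> real set \<Rightarrow> (real \<Rightarrow> real^'n) \<Rightarrow> bool" where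
  "geodesic_on g I c \<longleftrightarrow> open I \<and> is_interval I \<and>
     (\<exists>c'. \<forall>t\<in>I. (c has_vector_derivative c' t) (at t) \<and>
        (c' has_vector_derivative - christoffel_form g (c t) (c' t) (c' t)) (at t))"

text \<open>Every geodesic extends to a geodesic defined on the whole real line.\<close>

definition geodesically_complete :: "'n::finite metric_field \<Rightarrow> bool" where
  "geodesically_complete g \<longleftrightarrow> (\<forall>I c. geodesic_on g I c \<longrightarrow>
     (\<exists>d. geodesic_on g UNIV d \<and> (\<forall>t\<in>I. d t = c t)))"

definition geodesic_time_one :: "'n::finite metric_field \<Rightarrow> real^'n \<Rightarrow> real^'n \<Rightarrow> real^'n \<Rightarrow> bool" where
  "geodesic_time_one g p v q \<longleftrightarrow> (\<exists>I c. geodesic_on g I c \<and> 0 \<in> I \<and> 1 \<in> I \<and>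
     c 0 = p \<and> (c has_vector_derivative v) (at 0) \<and> c 1 = q)"

definition exp_domain :: "'n::finite metric_field \<Rightarrow> real^'n \<Rightarrow> (real^'n) set" where
  "exp_domain g p = {v. \<exists>q. geodesic_time_one g p v q}"

definition exp_map :: "'n::finite metric_field \<Rightarrow> real^'n \<Rightarrow> real^'n \<Rightarrow> real^'n" where
  "exp_map g p v = (THE q. geodesic_time_one g p v q)"

text \<open>A 0-model consists of a bilinear form \<open>ip\<close> and a 4-tensor \<open>A\<close> on a vector space.\<close>

definition has_0_model ::
  "'n::finite metric_field \<Rightarrow> ('v::euclidean_space \<Rightarrow> 'v \<Rightarrow> real) \<Rightarrow> ('v \<Rightarrow> 'v \<Rightarrow> 'v \<Rightarrow> 'v \<Rightarrow> real) \<Rightarrow> bool"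
  where
  "has_0_model g ip A \<longleftrightarrow> (\<forall>p. \<exists>\<Theta>. linear \<Theta> \<and> bij \<Theta> \<and>
     (\<forall>u v. ip (\<Theta> u) (\<Theta> v) = metric_at g p u v) \<and>
     (\<forall>x y z w. A (\<Theta> x) (\<Theta> y) (\<Theta> z) (\<Theta> w) = curv_tensor g p x y z w))"


section \<open>Tensors given by their non-zero components up to symmetry\<close>

text \<open>
  Each orbit of index tuples under the symmetries must occur at most once in the list.
\<close>

definition sym_components :: "(('i \<times> 'i) \<times> real) list \<Rightarrow> 'i \<Rightarrow> 'i \<Rightarrow> real" where
  "sym_components L i j = (\<Sum>((a, b), r)\<leftarrow>L. if (i, j) \<in> {(a, b), (b, a)} then r else 0)"

text \<open>
  The symmetries used are \<open>A(x,y,z,w) = - A(y,x,z,w) = - A(x,y,w,z) = A(z,w,x,y)\<close>.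
  The first Bianchi identity is not used to generate components; the list has to be compatible
  with it.
\<close>

definition curv_components :: "(('i \<times> 'i \<times> 'i \<times> 'i) \<times> real) list \<Rightarrow> 'i \<Rightarrow> 'i \<Rightarrow> 'i \<Rightarrow> 'i \<Rightarrow> real" where
  "curv_components L i j k l = (\<Sum>((a, b, c, d), r)\<leftarrow>L.
     if (i, j, k, l) \<in> {(a, b, c, d), (b, a, d, c), (c, d, a, b), (d, c, b, a)} then r
     else if (i, j, k, l) \<in> {(b, a, c, d), (a, b, d, c), (d, c, a, b), (c, d, b, a)} then - r
     else 0)"


section \<open>The metric\<close>

text \<open>
  The coordinates \<open>x\<^sub>i\<close>, \<open>x\<^sub>i\<^sup>*\<close>, \<open>y\<^sub>i\<^sub>,\<^sub>j\<close> are indexed by \<open>Xc i\<close>, \<open>Xs i\<close>, \<open>Yc i j\<close>.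
  The numeral types \<open>2\<close>, \<open>3\<close>, \<open>4\<close> have as elements the numerals from \<open>1\<close> up to their cardinality.
\<close>

datatype coord = Xc 3 | Xs 3 | Yc 4 2

lemma UNIV_coord:
  "(UNIV :: coord set) = range Xc \<union> range Xs \<union> range (\<lambda>(i, j). Yc i j)"
proof -
  have "c \<in> range Xc \<union> range Xs \<union> range (\<lambda>(i, j). Yc i j)" for c
    by (cases c) auto
  then show ?thesis by blast
qed

instance coord :: finite
  by standard (simp add: UNIV_coord)

lemma CARD_coord: "CARD(coord) = 14"
proof -
  have "card (range Xc \<union> range Xs \<union> range (\<lambda>(i, j). Yc i j))
      = card (range Xc \<union> range Xs) + card (range (\<lambda>(i, j). Yc i j))"
    by (rule card_Un_disjoint) auto
  also have "card (range Xc \<union> range Xs) = card (range Xc) + card (range Xs)"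
    by (rule card_Un_disjoint) auto
  also have "card (range Xc) = 3" by (subst card_image) (auto simp: inj_on_def)
  also have "card (range Xs) = 3" by (subst card_image) (auto simp: inj_on_def)
  also have "card (range (\<lambda>(i, j). Yc i j)) = 8" by (subst card_image) (auto simp: inj_on_def)
  finally show ?thesis by (simp add: UNIV_coord)
qed

definition g_list :: "(3 \<Rightarrow> 2 \<Rightarrow> real \<Rightarrow> real) \<Rightarrow> real^coord \<Rightarrow> ((coord \<times> coord) \<times> real) list" where
  "g_list \<phi> p = (let x = (\<lambda>i. p $ Xc i); y = (\<lambda>i j. p $ Yc i j) in
    [((Xc 1, Xs 1), 1), ((Xc 2, Xs 2), 1), ((Xc 3, Xs 3), 1),
     ((Yc 1 1, Yc 1 2), 1), ((Yc 2 1, Yc 2 2), 1), ((Yc 3 1, Yc 3 2), 1),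
     ((Yc 4 1, Yc 4 1), - 1/2), ((Yc 4 2, Yc 4 2), - 1/2), ((Yc 4 1, Yc 4 2), 1/4),
     ((Xc 1, Xc 1), - 2 * \<phi> 2 1 (x 2) * y 2 1 - 2 * \<phi> 3 1 (x 3) * y 3 1),
     ((Xc 2, Xc 2), - 2 * \<phi> 3 2 (x 3) * y 3 2 - 2 * \<phi> 1 2 (x 1) * y 1 2),
     ((Xc 3, Xc 3), - 2 * \<phi> 1 1 (x 1) * y 1 1 - 2 * \<phi> 2 2 (x 2) * y 2 2),
     ((Xc 2, Xc 3), x 1 * y 4 1),
     ((Xc 1, Xc 3), x 2 * y 4 2)])"

definition g_Phi :: "(3 \<Rightarrow> 2 \<Rightarrow> real \<Rightarrow> real) \<Rightarrow> coord metric_field" where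
  "g_Phi \<phi> p = (\<chi> i j. sym_components (g_list \<phi> p) i j)"

lemma sum_coord: "(\<Sum>c\<in>UNIV. f c) = (\<Sum>i\<in>UNIV. f (Xc i)) + (\<Sum>i\<in>UNIV. f (Xs i)) + (\<Sum>i\<in>UNIV. \<Sum>j\<in>UNIV. f (Yc i j))"
  for f :: "coord \<Rightarrow> 'a::comm_monoid_add"
proof -
  have "sum f (range Xc \<union> range Xs \<union> range (\<lambda>(i, j). Yc i j))
      = sum f (range Xc \<union> range Xs) + sum f (range (\<lambda>(i, j). Yc i j))"
    by (rule sum.union_disjoint) auto
  also have "sum f (range Xc \<union> range Xs) = sum f (range Xc) + sum f (range Xs)"
    by (rule sum.union_disjoint) auto
  also have "sum f (range Xc) = (\<Sum>i\<in>UNIV. f (Xc i))" by (subst sum.reindex) (auto simp: inj_on_def)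
  also have "sum f (range Xs) = (\<Sum>i\<in>UNIV. f (Xs i))" by (subst sum.reindex) (auto simp: inj_on_def)
  also have "sum f (range (\<lambda>(i, j). Yc i j)) = (\<Sum>i\<in>UNIV. \<Sum>j\<in>UNIV. f (Yc i j))"
    by (subst sum.reindex) (auto simp: inj_on_def sum.cartesian_product case_prod_beta)
  finally show ?thesis by (simp add: UNIV_coord)
qed

lemma g_Phi_symmetric: "g_Phi \<phi> p $ i $ j = g_Phi \<phi> p $ j $ i"
proof -
  have "((i, j) \<in> {(a, b), (b, a)}) = ((j, i) \<in> {(a, b), (b, a)})" for a b by auto
  then show ?thesis by (simp add: g_Phi_def sym_components_def)
qed

lemma g_Phi_invertible: "invertible (g_Phi \<phi> p)"
proof -
  have "v = 0" if "g_Phi \<phi> p *v v = 0" for v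
  proof -
    have row: "(\<Sum>j\<in>UNIV. g_Phi \<phi> p $ i $ j * v $ j) = 0" for i
      using that by (simp add: vec_eq_iff matrix_vector_mult_def)
    note ev = sum_coord sum_2 sum_3 sum_4 g_Phi_def g_list_def sym_components_def Let_def
    have x: "v $ Xc i = 0" for i
      using row[of "Xs 1"] row[of "Xs 2"] row[of "Xs 3"] exhaust_3[of i] by (auto simp: ev)
    have y: "v $ Yc i j = 0" for i j
      using row[of "Yc 1 1"] row[of "Yc 2 1"] row[of "Yc 3 1"] row[of "Yc 4 1"]
        row[of "Yc 1 2"] row[of "Yc 2 2"] row[of "Yc 3 2"] row[of "Yc 4 2"] exhaust_4[of i] exhaust_2[of j]
      by (auto simp: ev x)
    have "v $ Xs i = 0" for i
      using row[of "Xc 1"] row[of "Xc 2"] row[of "Xc 3"] exhaust_3[of i] by (auto simp: ev x y)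
    then show ?thesis using x y by (simp add: vec_eq_iff) (metis coord.exhaust)
  qed
  then show ?thesis by (meson invertible_left_inverse matrix_left_invertible_ker)
qed


section \<open>The model\<close>

text \<open>
  The basis of the model is the standard basis of \<open>real^coord\<close>; the same index type is used, with
  \<open>\<alpha>\<^sub>i\<close>, \<open>\<alpha>\<^sub>i\<^sup>*\<close>, \<open>\<beta>\<^sub>i\<^sub>,\<^sub>j\<close> indexed by \<open>Xc i\<close>, \<open>Xs i\<close>, \<open>Yc i j\<close>.
\<close>

abbreviation (input) \<alpha> :: "3 \<Rightarrow> coord" where "\<alpha> \<equiv> Xc"
abbreviation (input) \<alpha>s :: "3 \<Rightarrow> coord" where "\<alpha>s \<equiv> Xs"
abbreviation (input) \<beta> :: "4 \<Rightarrow> 2 \<Rightarrow> coord" where "\<beta> \<equiv> Yc"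

definition ip_list :: "((coord \<times> coord) \<times> real) list" where
  "ip_list =
    [((\<alpha> 1, \<alpha>s 1), 1), ((\<alpha> 2, \<alpha>s 2), 1), ((\<alpha> 3, \<alpha>s 3), 1),
     ((\<beta> 1 1, \<beta> 1 2), 1), ((\<beta> 2 1, \<beta> 2 2), 1), ((\<beta> 3 1, \<beta> 3 2), 1),
     ((\<beta> 4 1, \<beta> 4 1), - 1/2), ((\<beta> 4 2, \<beta> 4 2), - 1/2), ((\<beta> 4 1, \<beta> 4 2), 1/4)]"

definition A_list :: "((coord \<times> coord \<times> coord \<times> coord) \<times> real) list" where
  "A_list =
    [((\<alpha> 2, \<alpha> 1, \<alpha> 1, \<beta> 2 1), 1), ((\<alpha> 3, \<alpha> 1, \<alpha> 1, \<beta> 3 1), 1),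
     ((\<alpha> 3, \<alpha> 2, \<alpha> 2, \<beta> 3 2), 1), ((\<alpha> 1, \<alpha> 2, \<alpha> 2, \<beta> 1 2), 1),
     ((\<alpha> 1, \<alpha> 3, \<alpha> 3, \<beta> 1 1), 1), ((\<alpha> 2, \<alpha> 3, \<alpha> 3, \<beta> 2 2), 1),
     ((\<alpha> 1, \<alpha> 2, \<alpha> 3, \<beta> 4 1), - 1/2), ((\<alpha> 1, \<alpha> 3, \<alpha> 2, \<beta> 4 1), - 1/2),
     ((\<alpha> 2, \<alpha> 3, \<alpha> 1, \<beta> 4 2), - 1/2), ((\<alpha> 2, \<alpha> 1, \<alpha> 3, \<beta> 4 2), - 1/2)]"

definition M14_inner :: "real^coord \<Rightarrow> real^coord \<Rightarrow> real" where
  "M14_inner u v = (\<Sum>i\<in>UNIV. \<Sum>j\<in>UNIV. sym_components ip_list i j * u $ i * v $ j)"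

definition M14_A :: "real^coord \<Rightarrow> real^coord \<Rightarrow> real^coord \<Rightarrow> real^coord \<Rightarrow> real" where
  "M14_A x y z w = (\<Sum>i\<in>UNIV. \<Sum>j\<in>UNIV. \<Sum>k\<in>UNIV. \<Sum>l\<in>UNIV.
     curv_components A_list i j k l * x $ i * y $ j * z $ k * w $ l)"

end

theory Submission
  imports Defs
begin

text \<open>
  Give the coordinates \<open>x\<^sub>i\<close>, \<open>y\<^sub>i\<^sub>,\<^sub>j\<close>, \<open>x\<^sub>i\<^sup>*\<close> the levels 0, 1, 2. In the geodesic equation the
  acceleration of a coordinate depends only on positions and velocities of lower level. Picard
  iteration therefore becomes stationary after finitely many steps, each of which is an integral of a
  smooth function of initial velocity and time; so geodesics exist for all times and depend smoothly
  on the initial velocity. The map \<open>exp\<^sub>P\<close> has the form \<open>v + E v\<close> with the components of \<open>E v\<close> depending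
  only on components of \<open>v\<close> of lower level, and \<open>q - E v = v\<close> is solved by an iteration that is again
  finite.

  The curvature tensor is that of the model, rescaled by the \<open>\<phi>\<^sub>i\<^sub>,\<^sub>j'\<close>, plus components along the \<open>x\<^sub>i\<close>
  alone. The rescaling \<open>y\<^sub>i\<^sub>,\<^sub>j \<mapsto> \<phi>\<^sub>i\<^sub>,\<^sub>j' y\<^sub>i\<^sub>,\<^sub>j\<close> is an isometry because \<open>\<phi>\<^sub>i\<^sub>,\<^sub>1' \<phi>\<^sub>i\<^sub>,\<^sub>2' = 1\<close>, and the additional components
  are removed by tilting the \<open>x\<^sub>i\<close> directions. Self-adjointness gives
  \<open>g(J(x) J(y) z, w) = g(J(y) z, J(x) w)\<close>, where only the \<open>y\<close>-components matter, and this is symmetric in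
  \<open>x\<close> and \<open>y\<close>.
\<close>

section \<open>Calculus of smooth maps\<close>

text \<open>Derivatives are unique, so any explicit \<open>f'\<close> may replace the chosen
  \<open>frechet_derivative\<close> in the recursion for \<open>C_k\<close>.\<close>

lemma C_k_SucI:
  assumes "\<And>x. (f has_derivative f' x) (at x)" "\<And>v. C_k k (\<lambda>x. f' x v)"
  shows "C_k (Suc k) f"
proof -
  have "frechet_derivative f (at x) = f' x" for x
    using frechet_derivative_at[OF assms(1)] by simp
  then show ?thesis
    using assms by (auto simp: differentiable_def)
qed

lemma C_k_Suc_has_derivative:
  "C_k (Suc k) f \<Longrightarrow> (f has_derivative frechet_derivative f (at x)) (at x)"
  using frechet_derivative_works by auto

lemma C_k_continuous: "C_k k f \<Longrightarrow> continuous_on UNIV f"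
  by (cases k) (auto intro: continuous_at_imp_continuous_on differentiable_imp_continuous_within)

lemma C_k_SucD: "C_k (Suc k) f \<Longrightarrow> C_k k f"
proof (induction k arbitrary: f)
  case 0
  then show ?case using C_k_continuous[of "Suc 0" f] by simp
next
  case (Suc k)
  then show ?case by (metis C_k.simps(2))
qed

lemma C_k_const: "C_k k (\<lambda>_. c)"
proof (induction k arbitrary: c)
  case (Suc k)
  show ?case by (rule C_k_SucI[where f' = "\<lambda>_ _. 0"]) (use Suc in auto)
qed simp

lemma C_k_bounded_linear: "bounded_linear f \<Longrightarrow> C_k k f"
proof (cases k)
  case 0
  then show "bounded_linear f \<Longrightarrow> C_k k f" by (simp add: linear_continuous_on)
next
  case (Suc k')
  assume "bounded_linear f"
  then show ?thesis unfolding Suc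
    by (intro C_k_SucI[where f' = "\<lambda>_. f"]) (auto intro: bounded_linear_imp_has_derivative C_k_const)
qed

lemma C_k_add: "C_k k f \<Longrightarrow> C_k k g \<Longrightarrow> C_k k (\<lambda>x. f x + g x)"
proof (induction k arbitrary: f g)
  case 0
  then show ?case by (auto intro: continuous_intros)
next
  case (Suc k)
  show ?case
  proof (rule C_k_SucI)
    fix x
    show "((\<lambda>x. f x + g x) has_derivative
      (\<lambda>v. frechet_derivative f (at x) v + frechet_derivative g (at x) v)) (at x)"
      by (intro has_derivative_add C_k_Suc_has_derivative[OF Suc.prems(1)] C_k_Suc_has_derivative[OF Suc.prems(2)])
  next
    fix v
    show "C_k k (\<lambda>x. frechet_derivative f (at x) v + frechet_derivative g (at x) v)"
      using Suc by auto
  qed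
qed

lemma C_k_sum: "(\<And>i. i \<in> S \<Longrightarrow> C_k k (f i)) \<Longrightarrow> C_k k (\<lambda>x. \<Sum>i\<in>S. f i x)"
  by (induction S rule: infinite_finite_induct) (auto simp: C_k_const C_k_add)

lemma C_k_scaleR: "C_k k f \<Longrightarrow> C_k k g \<Longrightarrow> C_k k (\<lambda>x. f x *\<^sub>R g x)"
proof (induction k arbitrary: f g)
  case 0
  then show ?case by (auto intro: continuous_intros)
next
  case (Suc k)
  show ?case
  proof (rule C_k_SucI)
    fix x
    show "((\<lambda>x. f x *\<^sub>R g x) has_derivative
      (\<lambda>v. f x *\<^sub>R frechet_derivative g (at x) v + frechet_derivative f (at x) v *\<^sub>R g x)) (at x)"
      by (intro has_derivative_scaleR C_k_Suc_has_derivative[OF Suc.prems(1)] C_k_Suc_has_derivative[OF Suc.prems(2)])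
  next
    fix v
    \<comment> \<open>The product rule keeps undifferentiated factors, which have to be brought down
      to order \<open>k\<close>.\<close>
    have "C_k k f" "C_k k g" by (rule C_k_SucD[OF Suc.prems(1)], rule C_k_SucD[OF Suc.prems(2)])
    then show "C_k k (\<lambda>x. f x *\<^sub>R frechet_derivative g (at x) v + frechet_derivative f (at x) v *\<^sub>R g x)"
      using Suc by (intro C_k_add) auto
  qed
qed

lemma C_k_bounded_linear_compose:
  assumes "bounded_linear h" shows "C_k k f \<Longrightarrow> C_k k (\<lambda>x. h (f x))"
proof (induction k arbitrary: f)
  case 0
  then show ?case using assms by (auto intro: linear_continuous_on_compose bounded_linear.linear)
next
  case (Suc k)
  show ?case
  proof (rule C_k_SucI)
    fix x
    show "((\<lambda>x. h (f x)) has_derivative (\<lambda>v. h (frechet_derivative f (at x) v))) (at x)"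
      by (intro bounded_linear.has_derivative[OF assms] C_k_Suc_has_derivative[OF Suc.prems])
  next
    fix v
    show "C_k k (\<lambda>x. h (frechet_derivative f (at x) v))"
      using Suc by auto
  qed
qed

lemma C_k_componentwise: "C_k k f \<longleftrightarrow> (\<forall>b\<in>Basis. C_k k (\<lambda>x. f x \<bullet> b))"
proof
  assume "C_k k f"
  then show "\<forall>b\<in>Basis. C_k k (\<lambda>x. f x \<bullet> b)"
    by (auto intro: C_k_bounded_linear_compose[OF bounded_linear_inner_left])
next
  assume "\<forall>b\<in>Basis. C_k k (\<lambda>x. f x \<bullet> b)"
  then have "C_k k (\<lambda>x. \<Sum>b\<in>Basis. (f x \<bullet> b) *\<^sub>R b)"
    by (intro C_k_sum C_k_scaleR C_k_const) auto
  then show "C_k k f" by (simp add: euclidean_representation)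
qed

lemma C_k_compose: "C_k k f \<Longrightarrow> C_k k g \<Longrightarrow> C_k k (\<lambda>x. f (g x))"
proof (induction k arbitrary: f g)
  case 0
  then show ?case using continuous_on_compose2[of UNIV f UNIV g] by simp
next
  case (Suc k)
  let ?Df = "\<lambda>x. frechet_derivative f (at x)" and ?Dg = "\<lambda>x. frechet_derivative g (at x)"
  show ?case
  proof (rule C_k_SucI)
    fix x
    show "((\<lambda>x. f (g x)) has_derivative (\<lambda>v. ?Df (g x) (?Dg x v))) (at x)"
      by (rule has_derivative_compose[OF C_k_Suc_has_derivative[OF Suc.prems(2)] C_k_Suc_has_derivative[OF Suc.prems(1)]])
  next
    fix v
    \<comment> \<open>The direction \<open>?Dg x v\<close> varies with \<open>x\<close>, while
      \<open>C_k\<close> speaks of fixed directions; expansion in the basis leaves only fixed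
      ones.\<close>
    have "?Df (g x) (?Dg x v) = (\<Sum>b\<in>Basis. (?Dg x v \<bullet> b) *\<^sub>R ?Df (g x) b)" for x
    proof -
      have "linear (?Df (g x))"
        using C_k_Suc_has_derivative[OF Suc.prems(1)] has_derivative_linear by blast
      then have "(\<Sum>b\<in>Basis. (?Dg x v \<bullet> b) *\<^sub>R ?Df (g x) b) = ?Df (g x) (\<Sum>b\<in>Basis. (?Dg x v \<bullet> b) *\<^sub>R b)"
        by (simp add: linear_sum linear_cmul)
      then show ?thesis by (simp add: euclidean_representation)
    qed
    moreover have "C_k k (\<lambda>x. \<Sum>b\<in>Basis. (?Dg x v \<bullet> b) *\<^sub>R ?Df (g x) b)"
    proof (intro C_k_sum C_k_scaleR)
      fix b
      show "C_k k (\<lambda>x. ?Dg x v \<bullet> b)"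
        by (rule C_k_bounded_linear_compose[OF bounded_linear_inner_left]) (use Suc.prems(2) in auto)
      show "C_k k (\<lambda>x. ?Df (g x) b)"
        using Suc.prems(1) C_k_SucD[OF Suc.prems(2)] by (intro Suc.IH[of "\<lambda>y. ?Df y b" g]) auto
    qed
    ultimately show "C_k k (\<lambda>x. ?Df (g x) (?Dg x v))" by simp
  qed
qed

lemma C_k_Pair: "C_k k f \<Longrightarrow> C_k k g \<Longrightarrow> C_k k (\<lambda>x. (f x, g x))"
proof -
  assume "C_k k f" "C_k k g"
  then have "C_k k (\<lambda>x. (f x, 0) + (0, g x))"
    by (intro C_k_add C_k_bounded_linear_compose[of "\<lambda>u. (u, 0)" _ f]
        C_k_bounded_linear_compose[of "\<lambda>u. (0, u)" _ g])
      (auto intro: bounded_linear_Pair bounded_linear_ident bounded_linear_zero)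
  then show ?thesis by simp
qed

text \<open>Differentiation under the integral sign gives an integral of the same kind, with a
  partial derivative of \<open>H\<close> as integrand, so the induction runs over all
  \<open>H\<close>.\<close>

lemma C_k_integral:
  fixes H :: "'a::euclidean_space \<times> real \<Rightarrow> 'b::euclidean_space"
  shows "C_k k H \<Longrightarrow> C_k k (\<lambda>v. integral {0..1} (\<lambda>s. H (v, s)))"
proof (induction k arbitrary: H)
  case 0
  then have "continuous_on (UNIV \<times> cbox 0 (1::real)) (\<lambda>(v, s). H (v, s))"
    by (auto intro: continuous_on_subset)
  from integral_continuous_on_param[OF this] show ?case by (simp add: cbox_interval)
next
  case (Suc k)
  \<comment> \<open>\<open>leibniz_rule\<close> takes a continuous family of bounded operators,
    hence the packing by \<open>Blinfun\<close>.\<close>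
  define D where "D v s = Blinfun (\<lambda>w. frechet_derivative H (at (v, s)) (w, 0))" for v s
  have HD: "((\<lambda>v. H (v, s)) has_derivative (\<lambda>w. frechet_derivative H (at (v, s)) (w, 0))) (at v)" for v s
    by (rule has_derivative_compose[of "\<lambda>v. (v, s)" "\<lambda>w. (w, 0)" v UNIV H])
      (auto intro!: derivative_eq_intros C_k_Suc_has_derivative[OF Suc.prems])
  have D: "blinfun_apply (D v s) = (\<lambda>w. frechet_derivative H (at (v, s)) (w, 0))" for v s
    unfolding D_def using HD by (intro bounded_linear_Blinfun_apply) (rule has_derivative_bounded_linear)
  have contH: "continuous_on UNIV H" using Suc.prems by (rule C_k_continuous)
  have contD: "continuous_on UNIV (\<lambda>z. frechet_derivative H (at z) (w, 0))" for w
    using Suc.prems by (intro C_k_continuous[of k]) simp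
  have contDb: "continuous_on (UNIV \<times> cbox 0 1) (\<lambda>(v, s). D v s)"
    by (intro continuous_on_blinfun_componentwise)
      (auto simp: case_prod_beta D intro: continuous_on_subset[OF contD])
  have slice: "continuous_on {0..1} (\<lambda>s. D v s)" for v
    using continuous_on_compose2[OF contDb, of "{0..1}" "\<lambda>s. (v, s)"]
      continuous_on_Pair[OF continuous_on_const continuous_on_id]
    by (auto simp: cbox_interval)
  have int: "integral {0..1} (D v) w = integral {0..1} (\<lambda>s. frechet_derivative H (at (v, s)) (w, 0))" for v w
    using slice[of v] by (simp add: blinfun_apply_integral integrable_continuous_interval D)
  show ?case
  proof (rule C_k_SucI)
    fix v
    have "((\<lambda>v. integral (cbox 0 1) (\<lambda>s. H (v, s))) has_derivative integral (cbox 0 1) (D v)) (at v within UNIV)"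
      by (rule leibniz_rule[OF _ _ contDb])
        (auto simp: D HD cbox_interval intro!: integrable_continuous_interval continuous_on_compose2[OF contH] continuous_intros)
    then show "((\<lambda>v. integral {0..1} (\<lambda>s. H (v, s))) has_derivative integral {0..1} (D v)) (at v)"
      by (simp add: cbox_interval)
  next
    fix w
    show "C_k k (\<lambda>v. integral {0..1} (D v) w)"
      unfolding int using Suc by (intro Suc.IH) auto
  qed
qed

section \<open>Closure rules for smooth maps\<close>

lemma smooth_const: "smooth (\<lambda>_. c)" by (simp add: smooth_def C_k_const)
lemma smooth_bounded_linear: "bounded_linear f \<Longrightarrow> smooth f" by (simp add: smooth_def C_k_bounded_linear)
lemma smooth_add: "smooth f \<Longrightarrow> smooth g \<Longrightarrow> smooth (\<lambda>x. f x + g x)" by (simp add: smooth_def C_k_add)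
lemma smooth_scaleR: "smooth f \<Longrightarrow> smooth g \<Longrightarrow> smooth (\<lambda>x. f x *\<^sub>R g x)" by (simp add: smooth_def C_k_scaleR)
lemma smooth_compose: "smooth f \<Longrightarrow> smooth g \<Longrightarrow> smooth (\<lambda>x. f (g x))" by (simp add: smooth_def C_k_compose)
lemma smooth_Pair: "smooth f \<Longrightarrow> smooth g \<Longrightarrow> smooth (\<lambda>x. (f x, g x))" by (simp add: smooth_def C_k_Pair)
lemma smooth_continuous: "smooth f \<Longrightarrow> continuous_on UNIV f" by (auto simp: smooth_def intro: C_k_continuous)

lemma smooth_mult:
  fixes f g :: "'a::euclidean_space \<Rightarrow> real"
  shows "smooth f \<Longrightarrow> smooth g \<Longrightarrow> smooth (\<lambda>x. f x * g x)"
  using smooth_scaleR[of f g] by simp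

lemma smooth_minus: "smooth f \<Longrightarrow> smooth (\<lambda>x. - f x)"
  using smooth_scaleR[OF smooth_const[of "-1"]] by force

lemma smooth_diff: "smooth f \<Longrightarrow> smooth g \<Longrightarrow> smooth (\<lambda>x. f x - g x)"
  using smooth_add[of f "\<lambda>x. - g x"] smooth_minus[of g] by simp

lemma smooth_ident: "smooth (\<lambda>x. x)"
  by (rule smooth_bounded_linear) (rule bounded_linear_ident)

lemma smooth_fst: "smooth f \<Longrightarrow> smooth (\<lambda>x. fst (f x))"
  by (rule smooth_compose[OF smooth_bounded_linear[OF bounded_linear_fst]])

lemma smooth_snd: "smooth f \<Longrightarrow> smooth (\<lambda>x. snd (f x))"
  by (rule smooth_compose[OF smooth_bounded_linear[OF bounded_linear_snd]])

lemma smooth_vec_nth: "smooth f \<Longrightarrow> smooth (\<lambda>x. f x $ i)"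
  by (rule smooth_compose[OF smooth_bounded_linear[OF bounded_linear_vec_nth]])

lemmas smooth_intros = smooth_const smooth_ident smooth_add smooth_diff smooth_minus smooth_mult
  smooth_scaleR smooth_Pair smooth_fst smooth_snd smooth_vec_nth

lemma smooth_vec_lambda:
  fixes f :: "'a::euclidean_space \<Rightarrow> real^'n::finite"
  assumes "\<And>i. smooth (\<lambda>x. f x $ i)"
  shows "smooth f"
  using assms unfolding smooth_def C_k_componentwise[of _ f]
  by (auto simp: Basis_vec_def inner_axis)

text \<open>A linear map on the real line is multiplication by its value at \<open>1\<close>, which
  turns \<open>frechet_derivative\<close> into \<open>deriv\<close>.\<close>

lemma smooth_deriv:
  fixes f :: "real \<Rightarrow> real"
  assumes "smooth f"
  shows "(f has_real_derivative deriv f t) (at t)" "smooth (deriv f)"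
proof -
  have "(f has_derivative frechet_derivative f (at t)) (at t)" for t
    using assms C_k_Suc_has_derivative[of 0 f t] unfolding smooth_def by blast
  moreover from this have "frechet_derivative f (at t) h = frechet_derivative f (at t) 1 * h" for t h
    using linear_cmul[OF has_derivative_linear, of f _ "at t" h 1] by (simp add: mult.commute)
  ultimately have D: "(f has_real_derivative frechet_derivative f (at t) 1) (at t)" for t
    unfolding has_field_derivative_def by (metis (no_types, lifting) ext)
  then have eq: "deriv f = (\<lambda>t. frechet_derivative f (at t) 1)"
    by (auto intro: DERIV_imp_deriv)
  show "(f has_real_derivative deriv f t) (at t)"
    using D by (simp add: eq)
  have "C_k k (\<lambda>t. frechet_derivative f (at t) 1)" for k
    using assms C_k.simps(2)[of k f] unfolding smooth_def by blast
  then show "smooth (deriv f)"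
    by (simp add: smooth_def eq)
qed

section \<open>Triangular second order equations\<close>

text \<open>
  The indefinite time integral from \<open>0\<close>, rescaled to a fixed interval so that differentiation under
  the integral sign gives its smoothness, for times of either sign.
\<close>

definition prim :: "('a::euclidean_space \<times> real \<Rightarrow> 'b::euclidean_space) \<Rightarrow> 'a \<times> real \<Rightarrow> 'b" where
  "prim H = (\<lambda>(v, t). t *\<^sub>R integral {0..1} (\<lambda>s. H (v, t * s)))"

text \<open>The pair \<open>(v, t)\<close> is the parameter; the integrand is smooth in it and in
  \<open>s\<close> jointly, over a fixed interval.\<close>

lemma smooth_prim:
  assumes "smooth H" shows "smooth (prim H)"
proof -
  have "smooth (\<lambda>z. H (fst (fst z), snd (fst z) * snd z))"
    by (intro smooth_compose[OF assms] smooth_intros)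
  then have "smooth (\<lambda>z. integral {0..1} (\<lambda>s. H (fst z, snd z * s)))"
    unfolding smooth_def
    using C_k_integral[of _ "\<lambda>z. H (fst (fst z), snd (fst z) * snd z)"] by simp
  then have "smooth (\<lambda>z. snd z *\<^sub>R integral {0..1} (\<lambda>s. H (fst z, snd z * s)))"
    by (intro smooth_intros)
  then show ?thesis by (simp add: prim_def case_prod_unfold)
qed

lemma has_vector_derivative_prim:
  assumes "continuous_on UNIV H"
  shows "((\<lambda>t. prim H (v, t)) has_vector_derivative H (v, t)) (at t)"
proof -
  have cont: "continuous_on UNIV (\<lambda>t. H (v, t))"
    by (intro continuous_on_compose2[OF assms] continuous_intros) auto
  \<comment> \<open>An antiderivative on the whole line covers times of either sign; substituting
    \<open>t * s\<close> identifies \<open>prim H (v, t)\<close> with its increment from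
    \<open>0\<close> to \<open>t\<close>.\<close>
  then obtain F where F: "(F has_vector_derivative H (v, t)) (at t)" for t
    using einterval_antiderivative[of "-\<infinity>" \<infinity> "\<lambda>t. H (v, t)"]
    by (auto simp: continuous_on_eq_continuous_at)
  have "prim H (v, t) = F t - F 0" for t
  proof -
    have "((\<lambda>s. t *\<^sub>R H (v, t * s)) has_integral F (t * 1) - F (t * 0)) {0..1}"
    proof (rule fundamental_theorem_of_calculus)
      fix s :: real
      have "((*) t has_vector_derivative t) (at s)"
        by (auto intro!: derivative_eq_intros)
      from vector_diff_chain_at[OF this F]
      show "((\<lambda>s. F (t * s)) has_vector_derivative t *\<^sub>R H (v, t * s)) (at s within {0..1})"
        by (auto simp: o_def intro: has_vector_derivative_at_within)
    qed simp
    from integral_unique[OF this] show ?thesis by (simp add: prim_def)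
  qed
  then show ?thesis using F[of t] by (auto intro!: derivative_eq_intros)
qed

lemma prim_0: "prim H (v, 0) = 0"
  by (simp add: prim_def)

lemma prim_nth:
  fixes H :: "'a::euclidean_space \<times> real \<Rightarrow> real^'n::finite"
  assumes "continuous_on UNIV H"
  shows "prim H z $ k = prim (\<lambda>z. H z $ k) z"
proof -
  obtain v t where z: "z = (v, t)" by (cases z)
  have "(\<lambda>s. H (v, t * s)) integrable_on {0..1}"
    by (intro integrable_continuous_interval continuous_on_compose2[OF assms] continuous_intros) auto
  from integral_linear[OF this bounded_linear_vec_nth[of k]] show ?thesis
    by (simp add: prim_def z o_def)
qed

text \<open>After \<open>n\<close> steps of the iteration all components of level below
  \<open>n\<close> are settled. Hence \<open>R N\<close>, which is built from finitely many smooth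
  maps, is a two-sided inverse.\<close>

lemma triangular_diffeomorphism:
  fixes E :: "real^'n::finite \<Rightarrow> real^'n" and lev :: "'n \<Rightarrow> nat"
  assumes smooth: "smooth E"
    and triangular: "\<And>v w k. (\<And>j. lev j < lev k \<Longrightarrow> v $ j = w $ j) \<Longrightarrow> E v $ k = E w $ k"
  shows "diffeomorphism (\<lambda>v. v + E v)"
proof -
  define R where "R n q = ((\<lambda>w. q - E w) ^^ n) 0" for n q
  have R_Suc: "R (Suc n) q = q - E (R n q)" for n q by (simp add: R_def)
  have smooth_R: "smooth (R n)" for n
  proof (induction n)
    case 0
    then show ?case by (simp add: R_def smooth_const)
  next
    case (Suc n)
    have "smooth (\<lambda>q. q - E (R n q))"
      by (intro smooth_diff smooth_ident smooth_compose[OF smooth Suc])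
    then show ?case by (simp add: R_Suc)
  qed
  define N where "N = Suc (Max (range lev))"
  have N: "lev k < N" for k by (simp add: N_def less_Suc_eq_le)
  have "R n (v + E v) $ k = v $ k" if "lev k < n" for n v k
    using that
  proof (induction n arbitrary: k)
    case (Suc n)
    then have "E (R n (v + E v)) $ k = E v $ k"
      by (intro triangular) auto
    then show ?case by (simp add: R_Suc)
  qed simp
  then have left: "R N (v + E v) = v" for v by (simp add: vec_eq_iff N)
  have "R (Suc n) q $ k = R n q $ k" if "lev k < n" for n q k
    using that
  proof (induction n arbitrary: k)
    case (Suc n)
    then have "E (R (Suc n) q) $ k = E (R n q) $ k"
      by (intro triangular) auto
    then show ?case by (simp add: R_Suc)
  qed simp
  \<comment> \<open>Stationarity makes \<open>R N q\<close> a fixed point, which is the equation for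
    a preimage of \<open>q\<close>.\<close>
  then have "R (Suc N) q = R N q" for q by (simp add: vec_eq_iff N)
  then have right: "R N q + E (R N q) = q" for q by (metis R_Suc diff_add_cancel)
  have "bij (\<lambda>v. v + E v)"
    by (rule o_bij[of "R N"]) (auto simp: o_def left right)
  moreover have "inv (\<lambda>v. v + E v) = R N"
    by (rule inv_equality) (auto simp: left right)
  ultimately show ?thesis
    unfolding diffeomorphism_def by (auto simp: smooth_R intro: smooth_intros smooth)
qed

section \<open>Uniqueness of solutions of triangular equations\<close>

text \<open>The equation is \<open>c'' = F (c, c')\<close>. On level 0 the premise of
  \<open>triangular\<close> is vacuous, so the acceleration there is constant.\<close>

locale triangular_ode =
  fixes F :: "(real^'n::finite) \<times> (real^'n) \<Rightarrow> real^'n" and lev :: "'n \<Rightarrow> nat"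
  assumes smooth_F: "smooth F"
    and triangular: "\<And>p q u w k. (\<And>j. lev j < lev k \<Longrightarrow> p $ j = q $ j \<and> u $ j = w $ j)
      \<Longrightarrow> F (p, u) $ k = F (q, w) $ k"
begin

definition solution :: "real set \<Rightarrow> (real \<Rightarrow> real^'n) \<Rightarrow> (real \<Rightarrow> real^'n) \<Rightarrow> bool" where
  "solution I c c' \<longleftrightarrow> (\<forall>t\<in>I. (c has_vector_derivative c' t) (at t) \<and>
     (c' has_vector_derivative F (c t, c' t)) (at t))"

lemma solution_nth:
  assumes "solution I c c'" "t \<in> I"
  shows "((\<lambda>t. c t $ k) has_real_derivative c' t $ k) (at t)"
    "((\<lambda>t. c' t $ k) has_real_derivative F (c t, c' t) $ k) (at t)"
  using assms bounded_linear.has_vector_derivative[OF bounded_linear_vec_nth]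
  unfolding solution_def has_real_derivative_iff_has_vector_derivative by blast+

text \<open>Component \<open>k\<close> of the acceleration depends on lower levels only, so it is
  the same for both solutions and their difference has second derivative zero. Uniqueness and the
  triangular form of the endpoint map both rest on this.\<close>

lemma difference_affine:
  assumes sol: "solution I c c'" "solution I d d'" and I: "open I" "is_interval I" "t0 \<in> I" "t \<in> I"
    and lower: "\<And>j s. lev j < lev k \<Longrightarrow> s \<in> I \<Longrightarrow> c s $ j = d s $ j \<and> c' s $ j = d' s $ j"
  shows "c' t $ k - d' t $ k = c' t0 $ k - d' t0 $ k"
    "c t $ k - d t $ k = c t0 $ k - d t0 $ k + (t - t0) * (c' t0 $ k - d' t0 $ k)"
proof -
  have const: "f s = f t0" if der: "\<And>s. s \<in> I \<Longrightarrow> (f has_real_derivative 0) (at s)" and s: "s \<in> I"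
    for f :: "real \<Rightarrow> real" and s
  proof -
    have "(f has_derivative (\<lambda>x. 0)) (at x)" if "x \<in> I" for x
      using der[OF that] by (simp add: has_field_derivative_def lambda_zero)
    from has_derivative_zero_unique_connected[OF I(1) _ this s I(3)] show ?thesis
      using I(2) by (simp add: is_interval_connected)
  qed
  have vel: "c' s $ k - d' s $ k = c' t0 $ k - d' t0 $ k" if "s \<in> I" for s
  proof (rule const[OF _ that])
    fix s assume "s \<in> I"
    have "F (c s, c' s) $ k = F (d s, d' s) $ k"
      by (rule triangular) (rule lower[OF _ \<open>s \<in> I\<close>])
    then show "((\<lambda>s. c' s $ k - d' s $ k) has_real_derivative 0) (at s)"
      using DERIV_diff[OF solution_nth(2)[OF sol(1) \<open>s \<in> I\<close>, of k] solution_nth(2)[OF sol(2) \<open>s \<in> I\<close>, of k]]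
      by simp
  qed
  show "c' t $ k - d' t $ k = c' t0 $ k - d' t0 $ k" by (rule vel[OF \<open>t \<in> I\<close>])
  have "(c t $ k - d t $ k) - t * (c' t0 $ k - d' t0 $ k) = (c t0 $ k - d t0 $ k) - t0 * (c' t0 $ k - d' t0 $ k)"
  proof (rule const[of "\<lambda>t. (c t $ k - d t $ k) - t * (c' t0 $ k - d' t0 $ k)", OF _ \<open>t \<in> I\<close>])
    fix s assume "s \<in> I"
    show "((\<lambda>t. (c t $ k - d t $ k) - t * (c' t0 $ k - d' t0 $ k)) has_real_derivative 0) (at s)"
      using DERIV_diff[OF DERIV_diff[OF solution_nth(1)[OF sol(1) \<open>s \<in> I\<close>, of k] solution_nth(1)[OF sol(2) \<open>s \<in> I\<close>, of k]]
          DERIV_cmult_right[OF DERIV_ident, of "c' t0 $ k - d' t0 $ k"]] vel[OF \<open>s \<in> I\<close>]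
      by simp
  qed
  then show "c t $ k - d t $ k = c t0 $ k - d t0 $ k + (t - t0) * (c' t0 $ k - d' t0 $ k)"
    by (simp add: algebra_simps)
qed

text \<open>Induction over the levels. The bound \<open>m\<close> admits initial data that agree on
  low levels only, as happens when solutions with different initial velocities are compared.\<close>

lemma solutions_agree:
  assumes sol: "solution I c c'" "solution I d d'" and I: "open I" "is_interval I" "t0 \<in> I"
    and init: "\<And>k. lev k < m \<Longrightarrow> c t0 $ k = d t0 $ k \<and> c' t0 $ k = d' t0 $ k"
  shows "lev k < m \<Longrightarrow> t \<in> I \<Longrightarrow> c t $ k = d t $ k \<and> c' t $ k = d' t $ k"
proof (induction "lev k" arbitrary: k t rule: less_induct)
  case less
  then have lower: "c s $ j = d s $ j \<and> c' s $ j = d' s $ j" if "lev j < lev k" "s \<in> I" for j s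
    using that by auto
  have "c' t $ k - d' t $ k = c' t0 $ k - d' t0 $ k"
    "c t $ k - d t $ k = c t0 $ k - d t0 $ k + (t - t0) * (c' t0 $ k - d' t0 $ k)"
    by (rule difference_affine[OF sol I less.prems(2)], fact lower)+
  with init[OF less.prems(1)] show ?case by auto
qed

lemma solution_unique:
  assumes "solution I c c'" "solution I d d'" "open I" "is_interval I" "t0 \<in> I"
    and "c t0 = d t0" "c' t0 = d' t0" "t \<in> I"
  shows "c t = d t"
  unfolding vec_eq_iff
  using solutions_agree[OF assms(1-5), of "Suc (lev k)" k t for k] assms(6-) by auto

section \<open>Picard iteration and the flow\<close>

text \<open>The argument \<open>z\<close> consists of initial velocity and time. The start is the
  straight line, and the new position integrates the new velocity, so that one step settles one more
  level of both.\<close>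

primrec picard :: "real^'n \<Rightarrow> nat \<Rightarrow> (real^'n) \<times> real \<Rightarrow> (real^'n) \<times> (real^'n)" where
  "picard P 0 = (\<lambda>z. (P + snd z *\<^sub>R fst z, fst z))"
| "picard P (Suc n) = (let V = (\<lambda>z. fst z + prim (\<lambda>z. F (picard P n z)) z) in (\<lambda>z. (P + prim V z, V z)))"

lemma smooth_picard: "smooth (picard P n)"
proof (induction n)
  case 0
  show ?case by (simp, intro smooth_intros)
next
  case (Suc n)
  define V where "V = (\<lambda>z. fst z + prim (\<lambda>z. F (picard P n z)) z)"
  have "smooth V"
    unfolding V_def by (intro smooth_intros smooth_prim smooth_compose[OF smooth_F Suc])
  then have "smooth (\<lambda>z. (P + prim V z, V z))"
    by (intro smooth_Pair smooth_add smooth_const smooth_prim)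
  then show ?case by (simp add: V_def)
qed

lemma prim_cong_nth:
  fixes H G :: "(real^'n) \<times> real \<Rightarrow> real^'n"
  assumes "smooth H" "smooth G" "\<And>z. H z $ k = G z $ k"
  shows "prim H z $ k = prim G z $ k"
  using assms by (simp add: prim_nth smooth_continuous)

text \<open>\<open>F\<close> reads only lower levels, which are stationary by induction, and both
  integrations act componentwise.\<close>

lemma picard_stable:
  "lev k < n \<Longrightarrow> fst (picard P (Suc n) z) $ k = fst (picard P n z) $ k
     \<and> snd (picard P (Suc n) z) $ k = snd (picard P n z) $ k"
proof (induction n arbitrary: k z)
  case (Suc n)
  define V where "V m = (\<lambda>z. fst z + prim (\<lambda>z. F (picard P m z)) z)" for m
  have picard_Suc: "picard P (Suc m) z = (P + prim (V m) z, V m z)" for m z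
    by (simp add: V_def)
  have smooth_FP: "smooth (\<lambda>z. F (picard P m z))" for m
    by (intro smooth_compose[OF smooth_F smooth_picard])
  have smooth_V: "smooth (V m)" for m
    unfolding V_def by (intro smooth_intros smooth_prim smooth_FP)
  have "F (picard P (Suc n) z) $ k = F (picard P n z) $ k" for z
  proof -
    have "fst (picard P (Suc n) z) $ j = fst (picard P n z) $ j \<and> snd (picard P (Suc n) z) $ j = snd (picard P n z) $ j"
      if "lev j < lev k" for j
      using that Suc.prems by (intro Suc.IH) simp
    from triangular[OF this] show ?thesis by (simp only: prod.collapse)
  qed
  from prim_cong_nth[OF smooth_FP smooth_FP this] have V: "V (Suc n) z $ k = V n z $ k" for z
    unfolding V_def by (simp only: vector_add_component)
  from prim_cong_nth[OF smooth_V smooth_V this] have "prim (V (Suc n)) z $ k = prim (V n) z $ k" .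
  with V[of z] show ?case
    unfolding picard_Suc by (simp only: fst_conv snd_conv vector_add_component)
qed simp

text \<open>The number of steps exceeds every level, so all components are stationary.\<close>

definition flow :: "real^'n \<Rightarrow> (real^'n) \<times> real \<Rightarrow> (real^'n) \<times> (real^'n)" where
  "flow P = picard P (Suc (Max (range lev)))"

lemma smooth_flow: "smooth (flow P)"
  by (simp add: flow_def smooth_picard del: picard.simps)

lemma solution_flow: "solution UNIV (\<lambda>t. fst (flow P (v, t))) (\<lambda>t. snd (flow P (v, t)))"
proof -
  define N where "N = Suc (Max (range lev))"
  have "lev k < N" for k by (simp add: N_def less_Suc_eq_le)
  \<comment> \<open>A stationary iterate solves the integral equation; differentiating in time gives
    the differential equation.\<close>
  then have fix_N: "picard P (Suc N) = picard P N"
    by (intro ext prod_eqI) (simp_all add: vec_eq_iff picard_stable del: picard.simps)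
  define V where "V = (\<lambda>z. fst z + prim (\<lambda>z. F (picard P N z)) z)"
  have smooth_FP: "smooth (\<lambda>z. F (picard P N z))"
    by (intro smooth_compose[OF smooth_F smooth_picard])
  then have smooth_V: "smooth V"
    unfolding V_def by (intro smooth_intros smooth_prim)
  have flow: "(P + prim V z, V z) = flow P z" for z
    using fun_cong[OF fix_N, of z] unfolding flow_def N_def[symmetric] by (simp add: V_def)
  have "((\<lambda>t. V (v, t)) has_vector_derivative F (flow P (v, t))) (at t)" for t
    unfolding V_def flow_def N_def[symmetric]
    by (auto intro!: derivative_eq_intros has_vector_derivative_prim[OF smooth_continuous[OF smooth_FP]])
  moreover have "((\<lambda>t. P + prim V (v, t)) has_vector_derivative V (v, t)) (at t)" for t
    by (auto intro!: derivative_eq_intros has_vector_derivative_prim[OF smooth_continuous[OF smooth_V]])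
  ultimately show ?thesis unfolding solution_def flow[symmetric] by simp
qed

lemma flow_0: "flow P (v, 0) = (P, v)"
  by (simp add: flow_def prim_0)

text \<open>If \<open>v\<close> and \<open>w\<close> agree below the level of \<open>k\<close>, the
  two solutions agree there at all times and differ in component \<open>k\<close> by
  \<open>t * (v $ k - w $ k)\<close>. At time 1 this cancels against the subtracted velocities, so
  endpoint minus velocity is triangular.\<close>

lemma diffeomorphism_flow: "diffeomorphism (\<lambda>v. fst (flow P (v, 1)))"
proof -
  have "smooth (\<lambda>v. fst (flow P (v, 1)))"
    by (intro smooth_fst smooth_compose[OF smooth_flow] smooth_Pair smooth_ident smooth_const)
  then have smooth: "smooth (\<lambda>v. fst (flow P (v, 1)) - v)"
    by (intro smooth_diff smooth_ident)
  have "diffeomorphism (\<lambda>v. v + (fst (flow P (v, 1)) - v))"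
  proof (rule triangular_diffeomorphism[OF smooth, of lev])
    fix v w :: "real^'n" and k assume init: "\<And>j. lev j < lev k \<Longrightarrow> v $ j = w $ j"
    have lower: "fst (flow P (v, t)) $ j = fst (flow P (w, t)) $ j \<and> snd (flow P (v, t)) $ j = snd (flow P (w, t)) $ j"
      if "lev j < lev k" for j t
      by (rule solutions_agree[OF solution_flow solution_flow, of 0 "lev k"]) (use that in \<open>auto simp: flow_0 init\<close>)
    have "fst (flow P (v, 1)) $ k - fst (flow P (w, 1)) $ k
      = fst (flow P (v, 0)) $ k - fst (flow P (w, 0)) $ k + (1 - 0) * (snd (flow P (v, 0)) $ k - snd (flow P (w, 0)) $ k)"
      by (rule difference_affine(2)[OF solution_flow solution_flow open_UNIV _ UNIV_I UNIV_I]) (simp_all add: lower)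
    then show "(fst (flow P (v, 1)) - v) $ k = (fst (flow P (w, 1)) - w) $ k"
      by (simp add: flow_0)
  qed
  then show ?thesis by simp
qed

end

section \<open>Completeness and the exponential map\<close>

locale triangular_geodesics = triangular_ode F lev
  for F :: "(real^'n::finite) \<times> (real^'n) \<Rightarrow> real^'n" and lev +
  fixes g :: "'n metric_field"
  assumes F_christoffel: "F (p, u) = - christoffel_form g p u u"
begin

lemma geodesic_on_iff: "geodesic_on g I c \<longleftrightarrow> open I \<and> is_interval I \<and> (\<exists>c'. solution I c c')"
  by (simp add: geodesic_on_def solution_def F_christoffel)

text \<open>The equation is autonomous, so the flow, which starts at time 0, can be moved to any
  initial time.\<close>

lemma solution_shift:
  assumes "solution UNIV c c'" shows "solution UNIV (\<lambda>t. c (t - s)) (\<lambda>t. c' (t - s))"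
proof -
  have "((\<lambda>t. f (t - s)) has_vector_derivative y) (at t)" if "(f has_vector_derivative y) (at (t - s))"
    for f :: "real \<Rightarrow> real^'n" and y t
  proof -
    have "((\<lambda>t. t - s) has_vector_derivative 1) (at t)"
      by (auto intro!: derivative_eq_intros)
    from vector_diff_chain_at[OF this that] show ?thesis by (simp add: o_def)
  qed
  with assms show ?thesis by (simp add: solution_def)
qed

lemma complete: "geodesically_complete g"
  unfolding geodesically_complete_def
proof (intro allI impI)
  fix I c assume "geodesic_on g I c"
  then obtain c' where I: "open I" "is_interval I" and c: "solution I c c'"
    by (auto simp: geodesic_on_iff)
  \<comment> \<open>The empty set is a legitimate domain of a geodesic; in that case
    \<open>t0\<close> is arbitrary.\<close>
  obtain t0 where t0: "t0 \<in> I \<or> I = {}" by blast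
  define d where "d = (\<lambda>t. fst (flow (c t0) (c' t0, t - t0)))"
  define d' where "d' = (\<lambda>t. snd (flow (c t0) (c' t0, t - t0)))"
  have sol: "solution UNIV d d'"
    unfolding d_def d'_def by (rule solution_shift[OF solution_flow])
  then have "d t = c t" if "t \<in> I" for t
  proof -
    have "solution I d d'" using sol by (simp add: solution_def)
    moreover have "t0 \<in> I" using that t0 by auto
    ultimately show ?thesis
      by (rule solution_unique[OF _ c I, of d d' t0]) (use that in \<open>auto simp: d_def d'_def flow_0\<close>)
  qed
  with sol show "\<exists>d. geodesic_on g UNIV d \<and> (\<forall>t\<in>I. d t = c t)"
    by (auto simp: geodesic_on_iff)
qed

text \<open>By uniqueness every geodesic with these data follows the flow, so the definite
  description in \<open>exp_map\<close> denotes the flow at time 1.\<close>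

lemma geodesic_time_one_iff: "geodesic_time_one g P v q \<longleftrightarrow> q = fst (flow P (v, 1))"
proof
  assume "geodesic_time_one g P v q"
  then obtain I c c' where I: "open I" "is_interval I" "0 \<in> I" "1 \<in> I" and c: "solution I c c'"
    and init: "c 0 = P" "(c has_vector_derivative v) (at 0)" and q: "c 1 = q"
    by (auto simp: geodesic_time_one_def geodesic_on_iff)
  \<comment> \<open>\<open>geodesic_on\<close> hides the velocity behind an existential; uniqueness
    of derivatives recovers its initial value.\<close>
  have v: "c' 0 = v"
    using c I(3) by (intro vector_derivative_unique_at[OF _ init(2)]) (simp add: solution_def)
  have "solution I (\<lambda>t. fst (flow P (v, t))) (\<lambda>t. snd (flow P (v, t)))"
    using solution_flow by (simp add: solution_def)
  from solution_unique[OF c this I(1-3)] have "c 1 = fst (flow P (v, 1))"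
    using I(4) init(1) v by (simp add: flow_0)
  then show "q = fst (flow P (v, 1))" using q by simp
next
  assume "q = fst (flow P (v, 1))"
  moreover have "((\<lambda>t. fst (flow P (v, t))) has_vector_derivative v) (at 0)"
    using bspec[OF solution_flow[of P v, unfolded solution_def], of 0] by (simp add: flow_0)
  ultimately show "geodesic_time_one g P v q"
    using solution_flow[of P v] unfolding geodesic_time_one_def geodesic_on_iff
    by (intro exI[of _ "UNIV :: real set"] exI[of _ "\<lambda>t. fst (flow P (v, t))"] conjI
        exI[of _ "\<lambda>t. snd (flow P (v, t))"]) (simp_all add: flow_0)
qed

lemma exp_diffeomorphism: "exp_domain g P = UNIV \<and> diffeomorphism (exp_map g P)"
proof -
  have "exp_map g P = (\<lambda>v. fst (flow P (v, 1)))"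
    by (intro ext) (simp add: exp_map_def geodesic_time_one_iff)
  moreover have "exp_domain g P = UNIV"
    by (simp add: exp_domain_def geodesic_time_one_iff)
  ultimately show ?thesis
    using diffeomorphism_flow[of P] by simp
qed

end

section \<open>Coordinate formulas for connection and curvature\<close>

lemma metric_at_inner: "metric_at g p u v = u \<bullet> (g p *v v)"
  by (simp add: metric_at_def inner_vec_def matrix_vector_mult_def sum_distrib_left mult_ac)

text \<open>Vector identities are verified below by pairing with an arbitrary \<open>w\<close>,
  which avoids computing the inverse matrix.\<close>

lemma metric_at_nondegenerate:
  assumes "invertible (g p)" "\<And>w. metric_at g p u w = metric_at g p v w"
  shows "u = v"
proof -
  obtain B where "g p ** B = mat 1"
    using assms(1) unfolding invertible_def by blast
  then have "g p *v (B *v w) = w" for w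
    by (simp add: matrix_vector_mul_assoc)
  then have "u \<bullet> w = v \<bullet> w" for w
    using assms(2)[of "B *v w"] by (simp add: metric_at_inner)
  then show ?thesis using vector_eq_rdot[of u v] by blast
qed

lemma frechet_derivative_metric_at:
  assumes "\<And>i j. (\<lambda>q. g q $ i $ j) differentiable (at p)"
  shows "frechet_derivative (\<lambda>q. metric_at g q v w) (at p) u =
    (\<Sum>a\<in>UNIV. \<Sum>b\<in>UNIV. \<Sum>c\<in>UNIV. u $ a * v $ b * w $ c * partial_deriv a (\<lambda>q. g q $ b $ c) p)"
proof -
  let ?D = "\<lambda>b c. frechet_derivative (\<lambda>q. g q $ b $ c) (at p)"
  have D: "((\<lambda>q. g q $ b $ c) has_derivative ?D b c) (at p)" for b c
    using assms frechet_derivative_works by blast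
  have "((\<lambda>q. metric_at g q v w) has_derivative (\<lambda>u. \<Sum>b\<in>UNIV. \<Sum>c\<in>UNIV. ?D b c u * v $ b * w $ c)) (at p)"
    unfolding metric_at_def by (intro has_derivative_sum has_derivative_mult_left D)
  then have "frechet_derivative (\<lambda>q. metric_at g q v w) (at p) u = (\<Sum>b\<in>UNIV. \<Sum>c\<in>UNIV. ?D b c u * v $ b * w $ c)"
    by (simp flip: frechet_derivative_at)
  also have "\<dots> = (\<Sum>b\<in>UNIV. \<Sum>c\<in>UNIV. \<Sum>a\<in>UNIV. u $ a * v $ b * w $ c * partial_deriv a (\<lambda>q. g q $ b $ c) p)"
  proof (intro sum.cong refl)
    fix b c
    have "?D b c u = ?D b c (\<Sum>a\<in>UNIV. u $ a *\<^sub>R axis a 1)"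
      using basis_expansion[of u] by (simp add: scalar_mult_eq_scaleR)
    also have "\<dots> = (\<Sum>a\<in>UNIV. u $ a * ?D b c (axis a 1))"
      using has_derivative_linear[OF D[of b c]] by (simp add: linear_sum linear_cmul)
    finally show "?D b c u * v $ b * w $ c =
        (\<Sum>a\<in>UNIV. u $ a * v $ b * w $ c * partial_deriv a (\<lambda>q. g q $ b $ c) p)"
      by (simp add: partial_deriv_def sum_distrib_left sum_distrib_right mult_ac)
  qed
  also have "\<dots> = (\<Sum>b\<in>UNIV. \<Sum>a\<in>UNIV. \<Sum>c\<in>UNIV. u $ a * v $ b * w $ c * partial_deriv a (\<lambda>q. g q $ b $ c) p)"
    by (intro sum.cong refl sum.swap)
  also have "\<dots> = (\<Sum>a\<in>UNIV. \<Sum>b\<in>UNIV. \<Sum>c\<in>UNIV. u $ a * v $ b * w $ c * partial_deriv a (\<lambda>q. g q $ b $ c) p)"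
    by (rule sum.swap)
  finally show ?thesis .
qed

text \<open>The Koszul formula for constant fields, whose brackets vanish.\<close>

lemma koszul:
  fixes g :: "'n::finite metric_field"
  assumes sym: "\<And>q i j. g q $ i $ j = g q $ j $ i" and inv: "invertible (g p)"
    and diff: "\<And>i j. (\<lambda>q. g q $ i $ j) differentiable (at p)"
  defines "D \<equiv> \<lambda>u v w. frechet_derivative (\<lambda>q. metric_at g q v w) (at p) u"
  shows "metric_at g p (christoffel_form g p u v) w = (1/2) * (D u v w + D v u w - D w u v)"
proof -
  let ?d = "\<lambda>a b c. partial_deriv a (\<lambda>q. g q $ b $ c) p"
  have right: "g p ** matrix_inv (g p) = mat 1"
    using someI_ex[OF inv[unfolded invertible_def]] by (simp add: matrix_inv_def)
  \<comment> \<open>\<open>G a b\<close> is twice the Christoffel symbol with its upper index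
    lowered.\<close>
  define G where "G a b = (\<chi> l. ?d a b l + ?d b a l - ?d l a b)" for a b
  have \<Gamma>: "(\<chi> k. christoffel g p k a b) = (1/2) *\<^sub>R (matrix_inv (g p) *v G a b)" for a b
    by (simp add: vec_eq_iff christoffel_def G_def matrix_vector_mult_def)
  have "g p *v (\<chi> k. christoffel g p k a b) = (1/2) *\<^sub>R G a b" for a b
    unfolding \<Gamma> by (simp add: matrix_vector_mult_scaleR matrix_vector_mul_assoc right)
  then have lower: "(\<Sum>m\<in>UNIV. g p $ c $ m * christoffel g p m a b) = (1/2) * G a b $ c" for a b c
    by (simp add: vec_eq_iff matrix_vector_mult_def)
  have "metric_at g p (christoffel_form g p u v) w =
      (\<Sum>m\<in>UNIV. \<Sum>c\<in>UNIV. \<Sum>a\<in>UNIV. \<Sum>b\<in>UNIV. g p $ c $ m * christoffel g p m a b * u $ a * v $ b * w $ c)"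
    unfolding metric_at_def christoffel_form_def
    by (intro sum.cong refl) (simp add: sym[of p] sum_distrib_left sum_distrib_right mult_ac)
  also have "\<dots> = (\<Sum>m\<in>UNIV. \<Sum>(c, a, b)\<in>UNIV. g p $ c $ m * christoffel g p m a b * u $ a * v $ b * w $ c)"
    by (simp add: sum.cartesian_product flip: UNIV_Times_UNIV)
  also have "\<dots> = (\<Sum>(c, a, b)\<in>UNIV. \<Sum>m\<in>UNIV. g p $ c $ m * christoffel g p m a b * u $ a * v $ b * w $ c)"
    by (subst sum.swap) (simp add: case_prod_beta)
  also have "\<dots> = (\<Sum>(c, a, b)\<in>UNIV. (\<Sum>m\<in>UNIV. g p $ c $ m * christoffel g p m a b) * u $ a * v $ b * w $ c)"
    by (simp add: sum_distrib_right)
  also have "\<dots> = (1/2) * (\<Sum>(c, a, b)\<in>UNIV. G a b $ c * u $ a * v $ b * w $ c)"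
    by (simp only: lower) (simp add: sum_distrib_left case_prod_beta mult_ac)
  also have "(\<Sum>(c, a, b)\<in>UNIV. G a b $ c * u $ a * v $ b * w $ c) =
      (\<Sum>c\<in>UNIV. \<Sum>a\<in>UNIV. \<Sum>b\<in>UNIV. G a b $ c * u $ a * v $ b * w $ c)"
    by (simp add: sum.cartesian_product flip: UNIV_Times_UNIV)
  also have "\<dots> = (\<Sum>c\<in>UNIV. \<Sum>a\<in>UNIV. \<Sum>b\<in>UNIV. u $ a * v $ b * w $ c * ?d a b c)
      + (\<Sum>c\<in>UNIV. \<Sum>a\<in>UNIV. \<Sum>b\<in>UNIV. v $ b * u $ a * w $ c * ?d b a c)
      - (\<Sum>c\<in>UNIV. \<Sum>a\<in>UNIV. \<Sum>b\<in>UNIV. w $ c * u $ a * v $ b * ?d c a b)"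
    by (simp add: G_def sum.distrib sum_subtractf algebra_simps)
  also have "(\<Sum>c\<in>UNIV. \<Sum>a\<in>UNIV. \<Sum>b\<in>UNIV. u $ a * v $ b * w $ c * ?d a b c) = D u v w"
  proof -
    have "(\<Sum>c\<in>UNIV. \<Sum>a\<in>UNIV. \<Sum>b\<in>UNIV. u $ a * v $ b * w $ c * ?d a b c)
        = (\<Sum>a\<in>UNIV. \<Sum>c\<in>UNIV. \<Sum>b\<in>UNIV. u $ a * v $ b * w $ c * ?d a b c)"
      by (rule sum.swap)
    also have "\<dots> = (\<Sum>a\<in>UNIV. \<Sum>b\<in>UNIV. \<Sum>c\<in>UNIV. u $ a * v $ b * w $ c * ?d a b c)"
      by (intro sum.cong refl sum.swap)
    finally show ?thesis by (simp add: D_def frechet_derivative_metric_at[OF diff])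
  qed
  also have "(\<Sum>c\<in>UNIV. \<Sum>a\<in>UNIV. \<Sum>b\<in>UNIV. v $ b * u $ a * w $ c * ?d b a c) = D v u w"
  proof -
    have "(\<Sum>c\<in>UNIV. \<Sum>a\<in>UNIV. \<Sum>b\<in>UNIV. v $ b * u $ a * w $ c * ?d b a c)
        = (\<Sum>c\<in>UNIV. \<Sum>b\<in>UNIV. \<Sum>a\<in>UNIV. v $ b * u $ a * w $ c * ?d b a c)"
      by (intro sum.cong refl sum.swap)
    also have "\<dots> = (\<Sum>b\<in>UNIV. \<Sum>c\<in>UNIV. \<Sum>a\<in>UNIV. v $ b * u $ a * w $ c * ?d b a c)"
      by (rule sum.swap)
    also have "\<dots> = (\<Sum>b\<in>UNIV. \<Sum>a\<in>UNIV. \<Sum>c\<in>UNIV. v $ b * u $ a * w $ c * ?d b a c)"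
      by (intro sum.cong refl sum.swap)
    finally show ?thesis by (simp add: D_def frechet_derivative_metric_at[OF diff])
  qed
  also have "(\<Sum>c\<in>UNIV. \<Sum>a\<in>UNIV. \<Sum>b\<in>UNIV. w $ c * u $ a * v $ b * ?d c a b) = D w u v"
    by (simp add: D_def frechet_derivative_metric_at[OF diff])
  finally show ?thesis .
qed

text \<open>The Koszul formula and nondegeneracy determine the Christoffel form, so a candidate
  \<open>G\<close> can be verified without evaluating \<open>matrix_inv\<close>.\<close>

lemma christoffel_form_eqI:
  fixes g :: "'n::finite metric_field"
  assumes sym: "\<And>q i j. g q $ i $ j = g q $ j $ i" and inv: "invertible (g p)"
    and diff: "\<And>i j. (\<lambda>q. g q $ i $ j) differentiable (at p)"
    and D: "\<And>v w. ((\<lambda>q. metric_at g q v w) has_derivative (\<lambda>u. D u v w)) (at p)"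
    and G: "\<And>w. metric_at g p G w = (1/2) * (D u v w + D v u w - D w u v)"
  shows "christoffel_form g p u v = G"
proof (rule metric_at_nondegenerate[where g = g and p = p, OF inv])
  have "frechet_derivative (\<lambda>q. metric_at g q v w) (at p) u = D u v w" for u v w
    by (simp flip: frechet_derivative_at[OF D])
  then show "metric_at g p (christoffel_form g p u v) w = metric_at g p G w" for w
    by (simp add: koszul[OF sym inv diff] G)
qed

text \<open>On constant fields the covariant derivative is the Christoffel form and the bracket is
  zero.\<close>

lemma curv_op_eq:
  assumes "\<And>v w. ((\<lambda>q. christoffel_form g q v w) has_derivative (\<lambda>u. D u v w)) (at p)"
  shows "curv_op g p x y z = D x y z + christoffel_form g p x (christoffel_form g p y z)
    - (D y x z + christoffel_form g p y (christoffel_form g p x z))"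
proof -
  have nabla_const: "nabla g (\<lambda>_. u) (\<lambda>_. v) = (\<lambda>q. christoffel_form g q u v)" for u v
    by (auto simp: nabla_def)
  have "frechet_derivative (\<lambda>q. christoffel_form g q v w) (at p) u = D u v w" for u v w
    by (simp flip: frechet_derivative_at[OF assms])
  moreover have "nabla g (lie_bracket (\<lambda>_. x) (\<lambda>_. y)) (\<lambda>_. z) p = 0"
    by (simp add: nabla_def lie_bracket_def christoffel_form_def vec_eq_iff)
  ultimately show ?thesis
    unfolding curv_op_def curvature_field_def nabla_const by (simp add: nabla_def)
qed

lemma has_derivative_vecI:
  fixes f :: "'a::real_normed_vector \<Rightarrow> real^'n::finite"
  assumes "\<And>i. ((\<lambda>x. f x $ i) has_derivative (\<lambda>h. f' h $ i)) (at x)"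
  shows "(f has_derivative f') (at x)"
  using assms has_derivative_componentwise_within[of f f' x UNIV]
  by (auto simp: Basis_vec_def inner_axis)

section \<open>Sums over component lists\<close>

text \<open>A Kronecker delta used as a factor: sums over all indices collapse without enumerating
  index tuples.\<close>

definition indic :: "'i \<Rightarrow> 'i \<Rightarrow> real" where
  "indic a i = (if i = a then 1 else 0)"

lemma sum_indic: "(\<Sum>i\<in>UNIV. indic a i * f i) = f a" for f :: "'i::finite \<Rightarrow> real"
  by (simp add: indic_def if_distrib[of "\<lambda>x. x * _"] cong: if_cong)

lemma indic_Pair: "indic (a, b) (i, j) = indic a i * indic b j"
  by (simp add: indic_def)

lemma if_insert_indic:
  assumes "distinct [t1, t2, t3, t4, t5, t6, t7, t8]"
  shows "(if q \<in> {t1, t2, t3, t4} then r else if q \<in> {t5, t6, t7, t8} then - r else 0) =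
    r * (indic t1 q + indic t2 q + indic t3 q + indic t4 q - indic t5 q - indic t6 q - indic t7 q - indic t8 q)"
proof -
  consider "q = t1" | "q = t2" | "q = t3" | "q = t4" | "q = t5" | "q = t6" | "q = t7" | "q = t8"
    | "q \<notin> {t1, t2, t3, t4, t5, t6, t7, t8}" by blast
  then show ?thesis using assms by cases (auto simp: indic_def)
qed

text \<open>The orbit of a diagonal entry is one index pair, that of any other entry two, hence the
  case distinction.\<close>

lemma sum_sym_components:
  fixes u v :: "real^'n::finite"
  shows "(\<Sum>i\<in>UNIV. \<Sum>j\<in>UNIV. sym_components L i j * u $ i * v $ j) =
    (\<Sum>((a, b), r)\<leftarrow>L. r * (if a = b then u $ a * v $ b else u $ a * v $ b + u $ b * v $ a))"
proof (induction L)
  case Nil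
  then show ?case by (simp add: sym_components_def)
next
  case (Cons e L)
  obtain a b r where e: "e = ((a, b), r)" by (metis surj_pair)
  have two: "(\<Sum>i\<in>UNIV. \<Sum>j\<in>UNIV. (indic a i * u $ i) * (indic b j * v $ j)) = u $ a * v $ b" for a b
    by (simp add: sum_indic flip: sum_distrib_left sum_distrib_right)
  have "(\<Sum>i\<in>UNIV. \<Sum>j\<in>UNIV. (if (i, j) \<in> {(a, b), (b, a)} then r else 0) * u $ i * v $ j)
    = r * (if a = b then u $ a * v $ b else u $ a * v $ b + u $ b * v $ a)"
  proof (cases "a = b")
    case True
    then have eq: "(if (i, j) \<in> {(a, b), (b, a)} then r else 0) * u $ i * v $ j
      = r * ((indic a i * u $ i) * (indic b j * v $ j))" for i j
      by (simp add: indic_def)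
    have "(\<Sum>i\<in>UNIV. \<Sum>j\<in>UNIV. (if (i, j) \<in> {(a, b), (b, a)} then r else 0) * u $ i * v $ j)
      = r * (\<Sum>i\<in>UNIV. \<Sum>j\<in>UNIV. (indic a i * u $ i) * (indic b j * v $ j))"
      unfolding eq by (simp only: sum_distrib_left)
    then show ?thesis using True by (simp only: two if_True simp_thms)
  next
    case False
    then have eq: "(if (i, j) \<in> {(a, b), (b, a)} then r else 0) * u $ i * v $ j
      = r * ((indic a i * u $ i) * (indic b j * v $ j)) + r * ((indic b i * u $ i) * (indic a j * v $ j))" for i j
      by (auto simp: indic_def)
    have "(\<Sum>i\<in>UNIV. \<Sum>j\<in>UNIV. (if (i, j) \<in> {(a, b), (b, a)} then r else 0) * u $ i * v $ j)
      = r * (\<Sum>i\<in>UNIV. \<Sum>j\<in>UNIV. (indic a i * u $ i) * (indic b j * v $ j)) + r * (\<Sum>i\<in>UNIV. \<Sum>j\<in>UNIV. (indic b i * u $ i) * (indic a j * v $ j))"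
      unfolding eq by (simp only: sum_distrib_left sum.distrib)
    then show ?thesis using False by (simp only: two if_False distrib_left simp_thms)
  qed
  with Cons show ?case
    by (simp add: e sym_components_def distrib_right sum.distrib)
qed

definition wedge :: "'n \<Rightarrow> 'n \<Rightarrow> real^'n::finite \<Rightarrow> real^'n \<Rightarrow> real" where
  "wedge a b x y = x $ a * y $ b - x $ b * y $ a"

text \<open>Symmetric product of two elementary 2-forms; multiplied out, it is the signed sum over
  the orbit of \<open>(a, b, c, d)\<close> under the curvature symmetries.\<close>

definition wedge_sym :: "'n \<Rightarrow> 'n \<Rightarrow> 'n \<Rightarrow> 'n \<Rightarrow> real^'n::finite \<Rightarrow> real^'n \<Rightarrow> real^'n \<Rightarrow> real^'n \<Rightarrow> real" where
  "wedge_sym a b c d x y z w = wedge a b x y * wedge c d z w + wedge c d x y * wedge a b z w"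

text \<open>The hypothesis makes the eight tuples of each orbit distinct, so the nested conditionals
  become a signed sum of deltas.\<close>

lemma sum_curv_components:
  fixes x y z w :: "real^'n::finite"
  assumes "\<And>a b c d r. ((a, b, c, d), r) \<in> set L \<Longrightarrow> a \<noteq> b \<and> c \<noteq> d \<and> (a, b) \<noteq> (c, d) \<and> (a, b) \<noteq> (d, c)"
  shows "(\<Sum>i\<in>UNIV. \<Sum>j\<in>UNIV. \<Sum>k\<in>UNIV. \<Sum>l\<in>UNIV. curv_components L i j k l * x $ i * y $ j * z $ k * w $ l) =
    (\<Sum>((a, b, c, d), r)\<leftarrow>L. r * wedge_sym a b c d x y z w)"
  using assms
proof (induction L)
  case Nil
  then show ?case by (simp add: curv_components_def)
next
  case (Cons e L)
  obtain a b c d r where e: "e = ((a, b, c, d), r)" by (metis surj_pair)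
  let ?q = "\<lambda>a b c d i j k l. (indic a i * x $ i) * ((indic b j * y $ j) * ((indic c k * z $ k) * (indic d l * w $ l)))"
  have four: "(\<Sum>i\<in>UNIV. \<Sum>j\<in>UNIV. \<Sum>k\<in>UNIV. \<Sum>l\<in>UNIV. ?q a b c d i j k l) = x $ a * (y $ b * (z $ c * w $ d))" for a b c d
    by (simp add: sum_indic flip: sum_distrib_left sum_distrib_right)
  have ne: "a \<noteq> b" "c \<noteq> d" "\<not> (a = c \<and> b = d)" "\<not> (a = d \<and> b = c)"
    using Cons.prems[of a b c d r] by (auto simp: e)
  have "(if (i, j, k, l) \<in> {(a, b, c, d), (b, a, d, c), (c, d, a, b), (d, c, b, a)} then r
     else if (i, j, k, l) \<in> {(b, a, c, d), (a, b, d, c), (d, c, a, b), (c, d, b, a)} then - r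
     else 0) * x $ i * y $ j * z $ k * w $ l
    = r * (?q a b c d i j k l + ?q b a d c i j k l + ?q c d a b i j k l + ?q d c b a i j k l
      - ?q b a c d i j k l - ?q a b d c i j k l - ?q d c a b i j k l - ?q c d b a i j k l)" for i j k l
  proof -
    have "distinct [(a, b, c, d), (b, a, d, c), (c, d, a, b), (d, c, b, a),
        (b, a, c, d), (a, b, d, c), (d, c, a, b), (c, d, b, a)]"
      using ne by auto
    then show ?thesis
      by (simp only: if_insert_indic indic_Pair) algebra
  qed
  note eq = this
  have "(\<Sum>i\<in>UNIV. \<Sum>j\<in>UNIV. \<Sum>k\<in>UNIV. \<Sum>l\<in>UNIV.
     (if (i, j, k, l) \<in> {(a, b, c, d), (b, a, d, c), (c, d, a, b), (d, c, b, a)} then r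
     else if (i, j, k, l) \<in> {(b, a, c, d), (a, b, d, c), (d, c, a, b), (c, d, b, a)} then - r
     else 0) * x $ i * y $ j * z $ k * w $ l)
    = r * ( (\<Sum>i\<in>UNIV. \<Sum>j\<in>UNIV. \<Sum>k\<in>UNIV. \<Sum>l\<in>UNIV. ?q a b c d i j k l)
      + (\<Sum>i\<in>UNIV. \<Sum>j\<in>UNIV. \<Sum>k\<in>UNIV. \<Sum>l\<in>UNIV. ?q b a d c i j k l)
      + (\<Sum>i\<in>UNIV. \<Sum>j\<in>UNIV. \<Sum>k\<in>UNIV. \<Sum>l\<in>UNIV. ?q c d a b i j k l)
      + (\<Sum>i\<in>UNIV. \<Sum>j\<in>UNIV. \<Sum>k\<in>UNIV. \<Sum>l\<in>UNIV. ?q d c b a i j k l)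
      - (\<Sum>i\<in>UNIV. \<Sum>j\<in>UNIV. \<Sum>k\<in>UNIV. \<Sum>l\<in>UNIV. ?q b a c d i j k l)
      - (\<Sum>i\<in>UNIV. \<Sum>j\<in>UNIV. \<Sum>k\<in>UNIV. \<Sum>l\<in>UNIV. ?q a b d c i j k l)
      - (\<Sum>i\<in>UNIV. \<Sum>j\<in>UNIV. \<Sum>k\<in>UNIV. \<Sum>l\<in>UNIV. ?q d c a b i j k l)
      - (\<Sum>i\<in>UNIV. \<Sum>j\<in>UNIV. \<Sum>k\<in>UNIV. \<Sum>l\<in>UNIV. ?q c d b a i j k l))"
    unfolding eq by (simp only: sum_distrib_left sum.distrib sum_subtractf distrib_left right_diff_distrib)
  also have "\<dots> = r * wedge_sym a b c d x y z w"
    unfolding four by (simp add: wedge_sym_def wedge_def algebra_simps)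
  finally have one: "(\<Sum>i\<in>UNIV. \<Sum>j\<in>UNIV. \<Sum>k\<in>UNIV. \<Sum>l\<in>UNIV.
     (if (i, j, k, l) \<in> {(a, b, c, d), (b, a, d, c), (c, d, a, b), (d, c, b, a)} then r
     else if (i, j, k, l) \<in> {(b, a, c, d), (a, b, d, c), (d, c, a, b), (c, d, b, a)} then - r
     else 0) * x $ i * y $ j * z $ k * w $ l) = r * wedge_sym a b c d x y z w" .
  have split: "curv_components (e # L) i j k l =
     (if (i, j, k, l) \<in> {(a, b, c, d), (b, a, d, c), (c, d, a, b), (d, c, b, a)} then r
     else if (i, j, k, l) \<in> {(b, a, c, d), (a, b, d, c), (d, c, a, b), (c, d, b, a)} then - r
     else 0) + curv_components L i j k l" for i j k l
    by (simp only: curv_components_def e list.map sum_list.Cons prod.case)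
  have "(\<Sum>i\<in>UNIV. \<Sum>j\<in>UNIV. \<Sum>k\<in>UNIV. \<Sum>l\<in>UNIV. curv_components L i j k l * x $ i * y $ j * z $ k * w $ l) =
    (\<Sum>((a, b, c, d), r)\<leftarrow>L. r * wedge_sym a b c d x y z w)"
    by (rule Cons.IH, rule Cons.prems) (rule list.set_intros(2))
  then show ?case
    unfolding split distrib_right sum.distrib one by (simp only: e list.map sum_list.Cons prod.case)
qed

lemma M14_A_eq: "M14_A x y z w = (\<Sum>((a, b, c, d), r)\<leftarrow>A_list. r * wedge_sym a b c d x y z w)"
  unfolding M14_A_def by (rule sum_curv_components) (auto simp: A_list_def)

lemma M14_inner_eq: "M14_inner u v =
    u $ Xc 1 * v $ Xs 1 + u $ Xs 1 * v $ Xc 1 + u $ Xc 2 * v $ Xs 2 + u $ Xs 2 * v $ Xc 2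
    + u $ Xc 3 * v $ Xs 3 + u $ Xs 3 * v $ Xc 3
    + u $ Yc 1 1 * v $ Yc 1 2 + u $ Yc 1 2 * v $ Yc 1 1 + u $ Yc 2 1 * v $ Yc 2 2 + u $ Yc 2 2 * v $ Yc 2 1
    + u $ Yc 3 1 * v $ Yc 3 2 + u $ Yc 3 2 * v $ Yc 3 1
    - (1/2) * u $ Yc 4 1 * v $ Yc 4 1 - (1/2) * u $ Yc 4 2 * v $ Yc 4 2
    + (1/4) * (u $ Yc 4 1 * v $ Yc 4 2 + u $ Yc 4 2 * v $ Yc 4 1)"
  unfolding M14_inner_def sum_sym_components by (simp add: ip_list_def)

section \<open>The metric of the theorem\<close>

text \<open>Vectors without \<open>Xc\<close> components. The Christoffel form takes its values
  among them.\<close>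

definition vert :: "real \<Rightarrow> real \<Rightarrow> real \<Rightarrow> real \<Rightarrow> real \<Rightarrow> real \<Rightarrow> real \<Rightarrow> real \<Rightarrow> real \<Rightarrow> real \<Rightarrow> real \<Rightarrow> real^coord" where
  "vert s1 s2 s3 y11 y12 y21 y22 y31 y32 y41 y42 = (\<chi> c. case c of Xc i \<Rightarrow> 0
    | Xs i \<Rightarrow> (if i = 1 then s1 else if i = 2 then s2 else s3)
    | Yc i j \<Rightarrow> (if i = 1 then if j = 1 then y11 else y12 else if i = 2 then if j = 1 then y21 else y22
        else if i = 3 then if j = 1 then y31 else y32 else if j = 1 then y41 else y42))"

lemma vert_nth [simp]:
  "vert s1 s2 s3 y11 y12 y21 y22 y31 y32 y41 y42 $ Xc i = 0"
  "vert s1 s2 s3 y11 y12 y21 y22 y31 y32 y41 y42 $ Xs 1 = s1"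
  "vert s1 s2 s3 y11 y12 y21 y22 y31 y32 y41 y42 $ Xs 2 = s2"
  "vert s1 s2 s3 y11 y12 y21 y22 y31 y32 y41 y42 $ Xs 3 = s3"
  "vert s1 s2 s3 y11 y12 y21 y22 y31 y32 y41 y42 $ Yc 1 1 = y11"
  "vert s1 s2 s3 y11 y12 y21 y22 y31 y32 y41 y42 $ Yc 1 2 = y12"
  "vert s1 s2 s3 y11 y12 y21 y22 y31 y32 y41 y42 $ Yc 2 1 = y21"
  "vert s1 s2 s3 y11 y12 y21 y22 y31 y32 y41 y42 $ Yc 2 2 = y22"
  "vert s1 s2 s3 y11 y12 y21 y22 y31 y32 y41 y42 $ Yc 3 1 = y31"
  "vert s1 s2 s3 y11 y12 y21 y22 y31 y32 y41 y42 $ Yc 3 2 = y32"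
  "vert s1 s2 s3 y11 y12 y21 y22 y31 y32 y41 y42 $ Yc 4 1 = y41"
  "vert s1 s2 s3 y11 y12 y21 y22 y31 y32 y41 y42 $ Yc 4 2 = y42"
  by (simp_all add: vert_def)

lemma all_coord:
  "(\<forall>c. P c) \<longleftrightarrow> (\<forall>i. P (Xc i)) \<and> P (Xs 1) \<and> P (Xs 2) \<and> P (Xs 3)
    \<and> P (Yc 1 1) \<and> P (Yc 1 2) \<and> P (Yc 2 1) \<and> P (Yc 2 2) \<and> P (Yc 3 1) \<and> P (Yc 3 2) \<and> P (Yc 4 1) \<and> P (Yc 4 2)"
proof -
  have "(\<forall>c. P c) \<longleftrightarrow> (\<forall>i. P (Xc i)) \<and> (\<forall>i. P (Xs i)) \<and> (\<forall>i j. P (Yc i j))"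
    by (metis coord.exhaust)
  then show ?thesis by (simp add: forall_3 forall_4 forall_2)
qed

section \<open>The metric and its first derivatives\<close>

locale phi_family =
  fixes \<phi> :: "3 \<Rightarrow> 2 \<Rightarrow> real \<Rightarrow> real"
  assumes smooth_\<phi>: "smooth (\<phi> i j)"
    and deriv_prod: "deriv (\<phi> i 1) t * deriv (\<phi> i 2) t = 1"
begin

definition phi :: "3 \<Rightarrow> 2 \<Rightarrow> real^coord \<Rightarrow> real" where
  "phi i j p = \<phi> i j (p $ Xc i)"

definition phi' :: "3 \<Rightarrow> 2 \<Rightarrow> real^coord \<Rightarrow> real" where
  "phi' i j p = deriv (\<phi> i j) (p $ Xc i)"

definition phi'' :: "3 \<Rightarrow> 2 \<Rightarrow> real^coord \<Rightarrow> real" where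
  "phi'' i j p = deriv (deriv (\<phi> i j)) (p $ Xc i)"

lemma phi'_prod: "phi' i 1 p * phi' i 2 p = 1"
  by (simp add: phi'_def deriv_prod)

lemma smooth_phi:
  assumes "smooth f" shows "smooth (\<lambda>z. phi i j (f z))" "smooth (\<lambda>z. phi' i j (f z))"
  unfolding phi_def phi'_def
  by (rule smooth_compose[OF smooth_\<phi> smooth_vec_nth[OF assms]],
      rule smooth_compose[OF smooth_deriv(2)[OF smooth_\<phi>] smooth_vec_nth[OF assms]])

lemma has_derivative_nth [derivative_intros]:
  fixes p :: "real^'n::finite"
  shows "((\<lambda>q. q $ c) has_derivative (\<lambda>a. a $ c)) (at p)"
  by (rule bounded_linear_imp_has_derivative[OF bounded_linear_vec_nth])

lemma has_derivative_along_coord: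
  fixes h :: "real \<Rightarrow> real" and p :: "real^'n::finite"
  assumes "smooth h"
  shows "((\<lambda>q. h (q $ c)) has_derivative (\<lambda>a. deriv h (p $ c) * a $ c)) (at p)"
  by (rule has_derivative_compose[OF has_derivative_nth
      smooth_deriv(1)[OF assms, unfolded has_field_derivative_def]])

lemma has_derivative_phi [derivative_intros]:
  "((\<lambda>q. phi i j q) has_derivative (\<lambda>a. phi' i j p * a $ Xc i)) (at p)"
  "((\<lambda>q. phi' i j q) has_derivative (\<lambda>a. phi'' i j p * a $ Xc i)) (at p)"
  unfolding phi_def phi'_def phi''_def
  by (rule has_derivative_along_coord smooth_\<phi> smooth_deriv(2)[OF smooth_\<phi>])+

text \<open>The index \<open>i\<close> of type \<open>3\<close> and the index \<open>k\<close> of type \<open>4\<close> stand for the same number.\<close>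

definition dpair :: "3 \<Rightarrow> 4 \<Rightarrow> 2 \<Rightarrow> real^coord \<Rightarrow> real^coord \<Rightarrow> real" where
  "dpair i k j p a = phi' i j p * a $ Xc i * p $ Yc k j + phi i j p * a $ Yc k j"

text \<open>The second directional derivative of the product of \<open>phi i j\<close> with the
  coordinate \<open>Yc k j\<close>, whose first derivative is \<open>dpair\<close>.\<close>

definition ddpair :: "3 \<Rightarrow> 4 \<Rightarrow> 2 \<Rightarrow> real^coord \<Rightarrow> real^coord \<Rightarrow> real^coord \<Rightarrow> real" where
  "ddpair i k j p a b = phi'' i j p * a $ Xc i * b $ Xc i * p $ Yc k j
     + phi' i j p * (a $ Xc i * b $ Yc k j + b $ Xc i * a $ Yc k j)"

text \<open>The metric differs from the model only in products of \<open>Xc\<close> components, so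
  the two agree as soon as one argument has none.\<close>

lemma metric_at_g_Phi: "metric_at (g_Phi \<phi>) p u v = M14_inner u v
    - 2 * (phi 2 1 p * p $ Yc 2 1 + phi 3 1 p * p $ Yc 3 1) * (u $ Xc 1 * v $ Xc 1)
    - 2 * (phi 3 2 p * p $ Yc 3 2 + phi 1 2 p * p $ Yc 1 2) * (u $ Xc 2 * v $ Xc 2)
    - 2 * (phi 1 1 p * p $ Yc 1 1 + phi 2 2 p * p $ Yc 2 2) * (u $ Xc 3 * v $ Xc 3)
    + p $ Xc 1 * p $ Yc 4 1 * (u $ Xc 2 * v $ Xc 3 + u $ Xc 3 * v $ Xc 2)
    + p $ Xc 2 * p $ Yc 4 2 * (u $ Xc 1 * v $ Xc 3 + u $ Xc 3 * v $ Xc 1)"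
proof -
  have "metric_at (g_Phi \<phi>) p u v = (\<Sum>i\<in>UNIV. \<Sum>j\<in>UNIV. sym_components (g_list \<phi> p) i j * u $ i * v $ j)"
    by (simp add: metric_at_def g_Phi_def)
  then show ?thesis
    unfolding sum_sym_components by (simp add: g_list_def Let_def M14_inner_eq phi_def algebra_simps)
qed

definition dmetric :: "real^coord \<Rightarrow> real^coord \<Rightarrow> real^coord \<Rightarrow> real^coord \<Rightarrow> real" where
  "dmetric p a u v =
     - 2 * (dpair 2 2 1 p a + dpair 3 3 1 p a) * (u $ Xc 1 * v $ Xc 1)
     - 2 * (dpair 3 3 2 p a + dpair 1 1 2 p a) * (u $ Xc 2 * v $ Xc 2)
     - 2 * (dpair 1 1 1 p a + dpair 2 2 2 p a) * (u $ Xc 3 * v $ Xc 3)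
     + (a $ Xc 1 * p $ Yc 4 1 + p $ Xc 1 * a $ Yc 4 1) * (u $ Xc 2 * v $ Xc 3 + u $ Xc 3 * v $ Xc 2)
     + (a $ Xc 2 * p $ Yc 4 2 + p $ Xc 2 * a $ Yc 4 2) * (u $ Xc 1 * v $ Xc 3 + u $ Xc 3 * v $ Xc 1)"

lemma has_derivative_metric:
  "((\<lambda>q. metric_at (g_Phi \<phi>) q u v) has_derivative (\<lambda>a. dmetric p a u v)) (at p)"
  unfolding metric_at_g_Phi
  by (auto intro!: derivative_eq_intros simp: dmetric_def dpair_def fun_eq_iff algebra_simps)

lemma differentiable_g_Phi: "(\<lambda>q. g_Phi \<phi> q $ i $ j) differentiable (at p)"
proof -
  have "g_Phi \<phi> q $ i $ j = metric_at (g_Phi \<phi>) q (axis i 1) (axis j 1)" for q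
    by (simp add: metric_at_inner matrix_vector_mult_basis inner_axis' column_def)
  then show ?thesis
    using has_derivative_metric[of "axis i 1" "axis j 1" p] by (auto simp: differentiable_def)
qed

section \<open>The Levi-Civita connection\<close>

text \<open>The metric does not depend on the \<open>Xs\<close> coordinates, hence no
  \<open>Xc\<close> components. Raising an index exchanges \<open>Yc i 1\<close> and
  \<open>Yc i 2\<close> for \<open>i\<close> up to 3; inverting the block with entries -1/2 and 1/4
  produces the factors 4/3 and 2/3.\<close>

definition gamma :: "real^coord \<Rightarrow> real^coord \<Rightarrow> real^coord \<Rightarrow> real^coord" where
  "gamma p u v = vert
      (- (dpair 2 2 1 p u + dpair 3 3 1 p u) * v $ Xc 1
       - (dpair 2 2 1 p v + dpair 3 3 1 p v) * u $ Xc 1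
       + (1/2) * ((u $ Xc 2 * p $ Yc 4 2 + p $ Xc 2 * u $ Yc 4 2) * v $ Xc 3 + (v $ Xc 2 * p $ Yc 4 2 + p $ Xc 2 * v $ Yc 4 2) * u $ Xc 3)
       + phi' 1 2 p * p $ Yc 1 2 * (u $ Xc 2 * v $ Xc 2)
       + phi' 1 1 p * p $ Yc 1 1 * (u $ Xc 3 * v $ Xc 3)
       - (1/2) * p $ Yc 4 1 * (u $ Xc 2 * v $ Xc 3 + u $ Xc 3 * v $ Xc 2))
      (- (dpair 3 3 2 p u + dpair 1 1 2 p u) * v $ Xc 2
       - (dpair 3 3 2 p v + dpair 1 1 2 p v) * u $ Xc 2
       + (1/2) * ((u $ Xc 1 * p $ Yc 4 1 + p $ Xc 1 * u $ Yc 4 1) * v $ Xc 3 + (v $ Xc 1 * p $ Yc 4 1 + p $ Xc 1 * v $ Yc 4 1) * u $ Xc 3)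
       + phi' 2 1 p * p $ Yc 2 1 * (u $ Xc 1 * v $ Xc 1)
       + phi' 2 2 p * p $ Yc 2 2 * (u $ Xc 3 * v $ Xc 3)
       - (1/2) * p $ Yc 4 2 * (u $ Xc 1 * v $ Xc 3 + u $ Xc 3 * v $ Xc 1))
      (- (dpair 1 1 1 p u + dpair 2 2 2 p u) * v $ Xc 3
       - (dpair 1 1 1 p v + dpair 2 2 2 p v) * u $ Xc 3
       + (1/2) * ((u $ Xc 1 * p $ Yc 4 1 + p $ Xc 1 * u $ Yc 4 1) * v $ Xc 2 + (v $ Xc 1 * p $ Yc 4 1 + p $ Xc 1 * v $ Yc 4 1) * u $ Xc 2)
       + (1/2) * ((u $ Xc 2 * p $ Yc 4 2 + p $ Xc 2 * u $ Yc 4 2) * v $ Xc 1 + (v $ Xc 2 * p $ Yc 4 2 + p $ Xc 2 * v $ Yc 4 2) * u $ Xc 1)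
       + phi' 3 1 p * p $ Yc 3 1 * (u $ Xc 1 * v $ Xc 1)
       + phi' 3 2 p * p $ Yc 3 2 * (u $ Xc 2 * v $ Xc 2))
      (phi 1 2 p * (u $ Xc 2 * v $ Xc 2)) (phi 1 1 p * (u $ Xc 3 * v $ Xc 3))
      (phi 2 2 p * (u $ Xc 3 * v $ Xc 3)) (phi 2 1 p * (u $ Xc 1 * v $ Xc 1))
      (phi 3 2 p * (u $ Xc 2 * v $ Xc 2)) (phi 3 1 p * (u $ Xc 1 * v $ Xc 1))
      ((4/3) * p $ Xc 1 * (u $ Xc 2 * v $ Xc 3 + u $ Xc 3 * v $ Xc 2) + (2/3) * p $ Xc 2 * (u $ Xc 1 * v $ Xc 3 + u $ Xc 3 * v $ Xc 1))
      ((2/3) * p $ Xc 1 * (u $ Xc 2 * v $ Xc 3 + u $ Xc 3 * v $ Xc 2) + (4/3) * p $ Xc 2 * (u $ Xc 1 * v $ Xc 3 + u $ Xc 3 * v $ Xc 1))"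

lemma christoffel_form_eq: "christoffel_form (g_Phi \<phi>) p u v = gamma p u v"
proof (rule christoffel_form_eqI[OF g_Phi_symmetric g_Phi_invertible differentiable_g_Phi has_derivative_metric])
  fix w
  show "metric_at (g_Phi \<phi>) p (gamma p u v) w = (1/2) * (dmetric p u v w + dmetric p v u w - dmetric p w u v)"
    unfolding metric_at_g_Phi M14_inner_eq dmetric_def gamma_def vert_nth dpair_def by algebra
qed

definition dgamma :: "real^coord \<Rightarrow> real^coord \<Rightarrow> real^coord \<Rightarrow> real^coord \<Rightarrow> real^coord" where
  "dgamma p a u v = vert
      (- (ddpair 2 2 1 p a u + ddpair 3 3 1 p a u) * v $ Xc 1
       - (ddpair 2 2 1 p a v + ddpair 3 3 1 p a v) * u $ Xc 1
       + (1/2) * ((u $ Xc 2 * a $ Yc 4 2 + a $ Xc 2 * u $ Yc 4 2) * v $ Xc 3 + (v $ Xc 2 * a $ Yc 4 2 + a $ Xc 2 * v $ Yc 4 2) * u $ Xc 3)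
       + (phi'' 1 2 p * a $ Xc 1 * p $ Yc 1 2 + phi' 1 2 p * a $ Yc 1 2) * (u $ Xc 2 * v $ Xc 2)
       + (phi'' 1 1 p * a $ Xc 1 * p $ Yc 1 1 + phi' 1 1 p * a $ Yc 1 1) * (u $ Xc 3 * v $ Xc 3)
       - (1/2) * a $ Yc 4 1 * (u $ Xc 2 * v $ Xc 3 + u $ Xc 3 * v $ Xc 2))
      (- (ddpair 3 3 2 p a u + ddpair 1 1 2 p a u) * v $ Xc 2
       - (ddpair 3 3 2 p a v + ddpair 1 1 2 p a v) * u $ Xc 2
       + (1/2) * ((u $ Xc 1 * a $ Yc 4 1 + a $ Xc 1 * u $ Yc 4 1) * v $ Xc 3 + (v $ Xc 1 * a $ Yc 4 1 + a $ Xc 1 * v $ Yc 4 1) * u $ Xc 3)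
       + (phi'' 2 1 p * a $ Xc 2 * p $ Yc 2 1 + phi' 2 1 p * a $ Yc 2 1) * (u $ Xc 1 * v $ Xc 1)
       + (phi'' 2 2 p * a $ Xc 2 * p $ Yc 2 2 + phi' 2 2 p * a $ Yc 2 2) * (u $ Xc 3 * v $ Xc 3)
       - (1/2) * a $ Yc 4 2 * (u $ Xc 1 * v $ Xc 3 + u $ Xc 3 * v $ Xc 1))
      (- (ddpair 1 1 1 p a u + ddpair 2 2 2 p a u) * v $ Xc 3
       - (ddpair 1 1 1 p a v + ddpair 2 2 2 p a v) * u $ Xc 3
       + (1/2) * ((u $ Xc 1 * a $ Yc 4 1 + a $ Xc 1 * u $ Yc 4 1) * v $ Xc 2 + (v $ Xc 1 * a $ Yc 4 1 + a $ Xc 1 * v $ Yc 4 1) * u $ Xc 2)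
       + (1/2) * ((u $ Xc 2 * a $ Yc 4 2 + a $ Xc 2 * u $ Yc 4 2) * v $ Xc 1 + (v $ Xc 2 * a $ Yc 4 2 + a $ Xc 2 * v $ Yc 4 2) * u $ Xc 1)
       + (phi'' 3 1 p * a $ Xc 3 * p $ Yc 3 1 + phi' 3 1 p * a $ Yc 3 1) * (u $ Xc 1 * v $ Xc 1)
       + (phi'' 3 2 p * a $ Xc 3 * p $ Yc 3 2 + phi' 3 2 p * a $ Yc 3 2) * (u $ Xc 2 * v $ Xc 2))
      (phi' 1 2 p * a $ Xc 1 * (u $ Xc 2 * v $ Xc 2)) (phi' 1 1 p * a $ Xc 1 * (u $ Xc 3 * v $ Xc 3))
      (phi' 2 2 p * a $ Xc 2 * (u $ Xc 3 * v $ Xc 3)) (phi' 2 1 p * a $ Xc 2 * (u $ Xc 1 * v $ Xc 1))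
      (phi' 3 2 p * a $ Xc 3 * (u $ Xc 2 * v $ Xc 2)) (phi' 3 1 p * a $ Xc 3 * (u $ Xc 1 * v $ Xc 1))
      ((4/3) * a $ Xc 1 * (u $ Xc 2 * v $ Xc 3 + u $ Xc 3 * v $ Xc 2) + (2/3) * a $ Xc 2 * (u $ Xc 1 * v $ Xc 3 + u $ Xc 3 * v $ Xc 1))
      ((2/3) * a $ Xc 1 * (u $ Xc 2 * v $ Xc 3 + u $ Xc 3 * v $ Xc 2) + (4/3) * a $ Xc 2 * (u $ Xc 1 * v $ Xc 3 + u $ Xc 3 * v $ Xc 1))"

lemma has_derivative_dpair:
  "((\<lambda>q. dpair i k j q u) has_derivative (\<lambda>a. ddpair i k j p a u)) (at p)"
  unfolding dpair_def ddpair_def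
  by (auto intro!: derivative_eq_intros simp: fun_eq_iff algebra_simps)

lemma has_derivative_gamma: "((\<lambda>q. gamma q u v) has_derivative (\<lambda>a. dgamma p a u v)) (at p)"
proof (rule has_derivative_vecI)
  have "\<forall>c. ((\<lambda>q. gamma q u v $ c) has_derivative (\<lambda>a. dgamma p a u v $ c)) (at p)"
    unfolding all_coord gamma_def dgamma_def vert_nth
    by (auto intro!: derivative_eq_intros has_derivative_dpair simp: fun_eq_iff algebra_simps)
  then show "((\<lambda>q. gamma q u v $ c) has_derivative (\<lambda>a. dgamma p a u v $ c)) (at p)" for c
    by blast
qed

section \<open>The curvature tensor\<close>

lemma curv_op_g_Phi: "curv_op (g_Phi \<phi>) p x y z =
    dgamma p x y z + gamma p x (gamma p y z) - (dgamma p y x z + gamma p y (gamma p x z))"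
  using curv_op_eq[of "g_Phi \<phi>" "\<lambda>u v w. dgamma p u v w" p x y z] has_derivative_gamma
  by (simp add: christoffel_form_eq)

text \<open>\<open>Sab\<close> is the curvature component on the bivectors dual to the cross product
  components \<open>a\<close> and \<open>b\<close>, such as \<open>R(\<partial>\<^sub>x\<^sub>2, \<partial>\<^sub>x\<^sub>3, \<partial>\<^sub>x\<^sub>2, \<partial>\<^sub>x\<^sub>3)\<close> for \<open>S11\<close>; those for \<open>13\<close> and \<open>23\<close> vanish.\<close>

definition S11 :: "real^coord \<Rightarrow> real" where
  "S11 p = phi 1 1 p * phi 1 2 p - phi'' 2 2 p * p $ Yc 2 2 - phi'' 3 2 p * p $ Yc 3 2 + (2/3) * (p $ Xc 1 * p $ Xc 1)"

definition S22 :: "real^coord \<Rightarrow> real" where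
  "S22 p = phi 2 1 p * phi 2 2 p - phi'' 1 1 p * p $ Yc 1 1 - phi'' 3 1 p * p $ Yc 3 1 + (2/3) * (p $ Xc 2 * p $ Xc 2)"

definition S33 :: "real^coord \<Rightarrow> real" where
  "S33 p = phi 3 1 p * phi 3 2 p - phi'' 1 2 p * p $ Yc 1 2 - phi'' 2 1 p * p $ Yc 2 1"

definition S12 :: "real^coord \<Rightarrow> real" where
  "S12 p = - (1/3) * (p $ Xc 1 * p $ Xc 2)"

text \<open>The first ten terms are those of \<open>A_list\<close>, six of them weighted by
  \<open>phi'\<close>; the last four form a quadratic form on the bivectors in the \<open>Xc\<close>
  directions.\<close>

definition curv :: "real^coord \<Rightarrow> real^coord \<Rightarrow> real^coord \<Rightarrow> real^coord \<Rightarrow> real^coord \<Rightarrow> real" where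
  "curv p x y z w =
     phi' 2 1 p * wedge_sym (Xc 2) (Xc 1) (Xc 1) (Yc 2 1) x y z w
     + phi' 3 1 p * wedge_sym (Xc 3) (Xc 1) (Xc 1) (Yc 3 1) x y z w
     + phi' 3 2 p * wedge_sym (Xc 3) (Xc 2) (Xc 2) (Yc 3 2) x y z w
     + phi' 1 2 p * wedge_sym (Xc 1) (Xc 2) (Xc 2) (Yc 1 2) x y z w
     + phi' 1 1 p * wedge_sym (Xc 1) (Xc 3) (Xc 3) (Yc 1 1) x y z w
     + phi' 2 2 p * wedge_sym (Xc 2) (Xc 3) (Xc 3) (Yc 2 2) x y z w
     - (1/2) * (wedge_sym (Xc 1) (Xc 2) (Xc 3) (Yc 4 1) x y z w
       + wedge_sym (Xc 1) (Xc 3) (Xc 2) (Yc 4 1) x y z w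
       + wedge_sym (Xc 2) (Xc 3) (Xc 1) (Yc 4 2) x y z w
       + wedge_sym (Xc 2) (Xc 1) (Xc 3) (Yc 4 2) x y z w)
     + S11 p * (wedge (Xc 2) (Xc 3) x y * wedge (Xc 2) (Xc 3) z w)
     + S22 p * (wedge (Xc 3) (Xc 1) x y * wedge (Xc 3) (Xc 1) z w)
     + S33 p * (wedge (Xc 1) (Xc 2) x y * wedge (Xc 1) (Xc 2) z w)
     + S12 p * wedge_sym (Xc 2) (Xc 3) (Xc 3) (Xc 1) x y z w"

lemma curv_tensor_eq: "curv_tensor (g_Phi \<phi>) p x y z w = curv p x y z w"
  unfolding curv_tensor_def curv_op_g_Phi metric_at_g_Phi M14_inner_eq gamma_def dgamma_def vert_nth
    vector_add_component vector_minus_component dpair_def ddpair_def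
    curv_def wedge_sym_def wedge_def S11_def S22_def S33_def S12_def
  by algebra

section \<open>Triangularity of the geodesic equation\<close>

lemma smooth_gamma: "smooth (\<lambda>z. - gamma (fst z) (snd z) (snd z))"
proof (rule smooth_vec_lambda)
  have "\<forall>c. smooth (\<lambda>z. (- gamma (fst z) (snd z) (snd z)) $ c)"
    unfolding all_coord gamma_def vector_uminus_component vert_nth dpair_def
    by (intro conjI allI smooth_intros smooth_phi)
  then show "smooth (\<lambda>z. (- gamma (fst z) (snd z) (snd z)) $ c)" for c
    by blast
qed

definition level :: "coord \<Rightarrow> nat" where
  "level c = (case c of Xc _ \<Rightarrow> 0 | Yc _ _ \<Rightarrow> 1 | Xs _ \<Rightarrow> 2)"

lemma gamma_triangular:
  assumes "\<And>j. level j < level k \<Longrightarrow> p $ j = q $ j \<and> u $ j = w $ j"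
  shows "gamma p u u $ k = gamma q w w $ k"
proof -
  have "\<forall>k. (\<forall>j. level j < level k \<longrightarrow> p $ j = q $ j \<and> u $ j = w $ j) \<longrightarrow> gamma p u u $ k = gamma q w w $ k"
    unfolding all_coord gamma_def vert_nth
    by (simp add: level_def dpair_def phi_def phi'_def)
  with assms show ?thesis by blast
qed

text \<open>This transfers \<open>complete\<close> and \<open>exp_diffeomorphism\<close> to
  \<open>g_Phi\<close>.\<close>

sublocale triangular_geodesics "\<lambda>z. - gamma (fst z) (snd z) (snd z)" level "g_Phi \<phi>"
proof
  show "smooth (\<lambda>z. - gamma (fst z) (snd z) (snd z))" by (rule smooth_gamma)
  show "(- gamma (fst (p, u)) (snd (p, u)) (snd (p, u))) $ k = (- gamma (fst (q, w)) (snd (q, w)) (snd (q, w))) $ k"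
    if "\<And>j. level j < level k \<Longrightarrow> p $ j = q $ j \<and> u $ j = w $ j" for p q u w k
    using gamma_triangular[OF that] by simp
  show "- gamma (fst (p, u)) (snd (p, u)) (snd (p, u)) = - christoffel_form (g_Phi \<phi>) p u u" for p u
    by (simp add: christoffel_form_eq)
qed

section \<open>Jacobi operators\<close>

text \<open>Two vectors without \<open>Xc\<close> components are paired through their
  \<open>Yc\<close> components alone, so these are the components recorded.\<close>

lemma jacobi_nth:
  "jacobi (g_Phi \<phi>) p x v $ Xc i = 0"
  "jacobi (g_Phi \<phi>) p x v $ Yc 1 1 = phi' 1 2 p * (wedge (Xc 1) (Xc 2) v x * x $ Xc 2)"
  "jacobi (g_Phi \<phi>) p x v $ Yc 1 2 = phi' 1 1 p * (wedge (Xc 1) (Xc 3) v x * x $ Xc 3)"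
  "jacobi (g_Phi \<phi>) p x v $ Yc 2 1 = phi' 2 2 p * (wedge (Xc 2) (Xc 3) v x * x $ Xc 3)"
  "jacobi (g_Phi \<phi>) p x v $ Yc 2 2 = phi' 2 1 p * (wedge (Xc 2) (Xc 1) v x * x $ Xc 1)"
  "jacobi (g_Phi \<phi>) p x v $ Yc 3 1 = phi' 3 2 p * (wedge (Xc 3) (Xc 2) v x * x $ Xc 2)"
  "jacobi (g_Phi \<phi>) p x v $ Yc 3 2 = phi' 3 1 p * (wedge (Xc 3) (Xc 1) v x * x $ Xc 1)"
  "jacobi (g_Phi \<phi>) p x v $ Yc 4 1 =
     (4/3) * (wedge (Xc 1) (Xc 2) v x * x $ Xc 3 + wedge (Xc 1) (Xc 3) v x * x $ Xc 2)
     + (2/3) * (wedge (Xc 2) (Xc 3) v x * x $ Xc 1 + wedge (Xc 2) (Xc 1) v x * x $ Xc 3)"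
  "jacobi (g_Phi \<phi>) p x v $ Yc 4 2 =
     (2/3) * (wedge (Xc 1) (Xc 2) v x * x $ Xc 3 + wedge (Xc 1) (Xc 3) v x * x $ Xc 2)
     + (4/3) * (wedge (Xc 2) (Xc 3) v x * x $ Xc 1 + wedge (Xc 2) (Xc 1) v x * x $ Xc 3)"
  unfolding jacobi_def curv_op_g_Phi vector_add_component vector_minus_component gamma_def dgamma_def
    vert_nth wedge_def
  by (simp, algebra+)

lemma metric_at_jacobi: "metric_at (g_Phi \<phi>) p (jacobi (g_Phi \<phi>) p x v) w = curv p v x x w"
  using curv_tensor_eq[of p v x x w] by (simp add: curv_tensor_def jacobi_def)

lemma metric_at_jacobi_jacobi:
  "metric_at (g_Phi \<phi>) p (jacobi (g_Phi \<phi>) p x (jacobi (g_Phi \<phi>) p y z)) w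
    = M14_inner (jacobi (g_Phi \<phi>) p x w) (jacobi (g_Phi \<phi>) p y z)"
proof -
  let ?J = "jacobi (g_Phi \<phi>) p"
  have "metric_at (g_Phi \<phi>) p (?J x (?J y z)) w = curv p (?J y z) x x w"
    by (rule metric_at_jacobi)
  \<comment> \<open>The curvature symmetries make the Jacobi operator of \<open>x\<close>
    self-adjoint.\<close>
  also have "\<dots> = curv p w x x (?J y z)"
    unfolding curv_def wedge_sym_def wedge_def by algebra
  also have "\<dots> = metric_at (g_Phi \<phi>) p (?J x w) (?J y z)"
    by (rule metric_at_jacobi[symmetric])
  also have "\<dots> = M14_inner (?J x w) (?J y z)"
    by (simp add: metric_at_g_Phi jacobi_nth(1))
  finally show ?thesis .
qed

text \<open>With the products of the \<open>phi'\<close> equal to 1, the pairing no longer depends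
  on \<open>p\<close>. The three pairs of \<open>Yc\<close> components and the fourth block are
  symmetric in \<open>x\<close> and \<open>y\<close> only when added together.\<close>

lemma inner_jacobi_jacobi:
  "M14_inner (jacobi (g_Phi \<phi>) p x w) (jacobi (g_Phi \<phi>) p y z) =
    M14_inner (jacobi (g_Phi \<phi>) p y w) (jacobi (g_Phi \<phi>) p x z)"
proof -
  \<comment> \<open>A ring identity in which \<open>\<phi>\<^sub>i\<^sub>,\<^sub>1' \<phi>\<^sub>i\<^sub>,\<^sub>2' = 1\<close> enters only through the explicit multiples.\<close>
  have "M14_inner (jacobi (g_Phi \<phi>) p x w) (jacobi (g_Phi \<phi>) p y z) =
    M14_inner (jacobi (g_Phi \<phi>) p y w) (jacobi (g_Phi \<phi>) p x z)
    + (phi' 1 1 p * phi' 1 2 p - 1) *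
       ((wedge (Xc 1) (Xc 2) w x * x $ Xc 2) * (wedge (Xc 1) (Xc 3) z y * y $ Xc 3)
        + (wedge (Xc 1) (Xc 3) w x * x $ Xc 3) * (wedge (Xc 1) (Xc 2) z y * y $ Xc 2)
        - (wedge (Xc 1) (Xc 2) w y * y $ Xc 2) * (wedge (Xc 1) (Xc 3) z x * x $ Xc 3)
        - (wedge (Xc 1) (Xc 3) w y * y $ Xc 3) * (wedge (Xc 1) (Xc 2) z x * x $ Xc 2))
    + (phi' 2 1 p * phi' 2 2 p - 1) *
       ((wedge (Xc 2) (Xc 3) w x * x $ Xc 3) * (wedge (Xc 2) (Xc 1) z y * y $ Xc 1)
        + (wedge (Xc 2) (Xc 1) w x * x $ Xc 1) * (wedge (Xc 2) (Xc 3) z y * y $ Xc 3)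
        - (wedge (Xc 2) (Xc 3) w y * y $ Xc 3) * (wedge (Xc 2) (Xc 1) z x * x $ Xc 1)
        - (wedge (Xc 2) (Xc 1) w y * y $ Xc 1) * (wedge (Xc 2) (Xc 3) z x * x $ Xc 3))
    + (phi' 3 1 p * phi' 3 2 p - 1) *
       ((wedge (Xc 3) (Xc 2) w x * x $ Xc 2) * (wedge (Xc 3) (Xc 1) z y * y $ Xc 1)
        + (wedge (Xc 3) (Xc 1) w x * x $ Xc 1) * (wedge (Xc 3) (Xc 2) z y * y $ Xc 2)
        - (wedge (Xc 3) (Xc 2) w y * y $ Xc 2) * (wedge (Xc 3) (Xc 1) z x * x $ Xc 1)
        - (wedge (Xc 3) (Xc 1) w y * y $ Xc 1) * (wedge (Xc 3) (Xc 2) z x * x $ Xc 2))"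
    unfolding M14_inner_eq jacobi_nth wedge_def by algebra
  then show ?thesis by (simp add: phi'_prod)
qed

lemma jacobi_tsankov: "jacobi_tsankov (g_Phi \<phi>)"
  unfolding jacobi_tsankov_def
proof (intro allI ext)
  fix p x y z
  show "(jacobi (g_Phi \<phi>) p x \<circ> jacobi (g_Phi \<phi>) p y) z = (jacobi (g_Phi \<phi>) p y \<circ> jacobi (g_Phi \<phi>) p x) z"
    by (rule metric_at_nondegenerate[where g = "g_Phi \<phi>" and p = p, OF g_Phi_invertible])
      (simp add: metric_at_jacobi_jacobi inner_jacobi_jacobi[of p x])
qed

lemma not_two_step_jacobi_nilpotent: "\<not> two_step_jacobi_nilpotent (g_Phi \<phi>)"
proof
  \<comment> \<open>For \<open>e 2\<close> as argument, the operator of \<open>e 1\<close> yields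
    \<open>phi' 2 1\<close> in component \<open>Yc 2 2\<close> and that of \<open>e 3\<close> yields
    \<open>phi' 2 2\<close> in \<open>Yc 2 1\<close>; their pairing is the product, which is
    1.\<close>
  define e :: "3 \<Rightarrow> real^coord" where "e i = axis (Xc i) 1" for i
  assume "two_step_jacobi_nilpotent (g_Phi \<phi>)"
  then have "jacobi (g_Phi \<phi>) 0 (e 1) (jacobi (g_Phi \<phi>) 0 (e 3) (e 2)) = 0"
    unfolding two_step_jacobi_nilpotent_def by (metis comp_apply)
  then have "M14_inner (jacobi (g_Phi \<phi>) 0 (e 1) (e 2)) (jacobi (g_Phi \<phi>) 0 (e 3) (e 2)) = 0"
    using metric_at_jacobi_jacobi[of 0 "e 1" "e 3" "e 2" "e 2"] by (simp add: metric_at_def)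
  moreover have "M14_inner (jacobi (g_Phi \<phi>) 0 (e 1) (e 2)) (jacobi (g_Phi \<phi>) 0 (e 3) (e 2)) = 1"
    unfolding M14_inner_eq jacobi_nth by (simp add: e_def wedge_def axis_def phi'_prod)
  ultimately show False by simp
qed

text \<open>
  The isometry onto the model. The \<open>X\<close>-parts added to the \<open>Y\<close>-components absorb the curvature
  components with all arguments along the \<open>x\<^sub>i\<close>; the \<open>Xs\<close>-components then restore the inner product.
\<close>

definition theta :: "real^coord \<Rightarrow> real^coord \<Rightarrow> real^coord" where
  "theta p u = (\<chi> c. case c of Xc i \<Rightarrow> u $ Xc i | _ \<Rightarrow> 0) + vert
     (u $ Xs 1 - (phi 2 1 p * p $ Yc 2 1 + phi 3 1 p * p $ Yc 3 1) * u $ Xc 1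
       + (1/2) * (p $ Xc 2 * p $ Yc 4 2) * u $ Xc 3)
     (u $ Xs 2 - (phi 3 2 p * p $ Yc 3 2 + phi 1 2 p * p $ Yc 1 2) * u $ Xc 2
       + (1/2) * (p $ Xc 1 * p $ Yc 4 1) * u $ Xc 3
       - S12 p * phi' 1 2 p * u $ Yc 1 2 + (1/2) * S33 p * phi' 2 2 p * u $ Yc 2 2)
     (u $ Xs 3 - (phi 1 1 p * p $ Yc 1 1 + phi 2 2 p * p $ Yc 2 2) * u $ Xc 3
       + (1/2) * (p $ Xc 2 * p $ Yc 4 2) * u $ Xc 1 + (1/2) * (p $ Xc 1 * p $ Yc 4 1) * u $ Xc 2
       + (1/2) * S22 p * phi' 3 2 p * u $ Yc 3 2 + (1/2) * S11 p * phi' 3 1 p * u $ Yc 3 1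
       - (1/4) * S11 p * S22 p * u $ Xc 3)
     (phi' 1 1 p * u $ Yc 1 1 + S12 p * u $ Xc 2) (phi' 1 2 p * u $ Yc 1 2)
     (phi' 2 1 p * u $ Yc 2 1 - (1/2) * S33 p * u $ Xc 2) (phi' 2 2 p * u $ Yc 2 2)
     (phi' 3 1 p * u $ Yc 3 1 - (1/2) * S22 p * u $ Xc 3) (phi' 3 2 p * u $ Yc 3 2 - (1/2) * S11 p * u $ Xc 3)
     (u $ Yc 4 1) (u $ Yc 4 2)"

lemma theta_eval:
  "(\<chi> c. case c of Xc i \<Rightarrow> u $ Xc i | _ \<Rightarrow> 0) $ Xc i = u $ Xc i"
  "(\<chi> c. case c of Xc i \<Rightarrow> u $ Xc i | _ \<Rightarrow> 0) $ Xs i = 0"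
  "(\<chi> c. case c of Xc i \<Rightarrow> u $ Xc i | _ \<Rightarrow> 0) $ Yc k j = 0"
  by simp_all

lemma linear_theta: "linear (theta p)"
proof (rule linearI)
  show "theta p (u + v) = theta p u + theta p v" for u v
    unfolding vec_eq_iff all_coord theta_def vector_add_component vert_nth theta_eval
    by (simp add: algebra_simps add_divide_distrib)
  show "theta p (c *\<^sub>R u) = c *\<^sub>R theta p u" for c u
    unfolding vec_eq_iff all_coord theta_def vector_add_component vector_scaleR_component vert_nth theta_eval
    by (simp add: algebra_simps add_divide_distrib)
qed

lemma inner_theta: "M14_inner (theta p u) (theta p v) = metric_at (g_Phi \<phi>) p u v"
proof -
  \<comment> \<open>The explicit multiples of \<open>phi' i 1 p * phi' i 2 p - 1\<close> make this
    an unconditional polynomial identity.\<close>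
  have "M14_inner (theta p u) (theta p v) = metric_at (g_Phi \<phi>) p u v
    + (phi' 1 1 p * phi' 1 2 p - 1) * (u $ Yc 1 1 * v $ Yc 1 2 + u $ Yc 1 2 * v $ Yc 1 1)
    + (phi' 2 1 p * phi' 2 2 p - 1) * (u $ Yc 2 1 * v $ Yc 2 2 + u $ Yc 2 2 * v $ Yc 2 1)
    + (phi' 3 1 p * phi' 3 2 p - 1) * (u $ Yc 3 1 * v $ Yc 3 2 + u $ Yc 3 2 * v $ Yc 3 1)"
    unfolding metric_at_g_Phi M14_inner_eq theta_def vector_add_component vert_nth theta_eval by algebra
  then show ?thesis by (simp add: phi'_prod)
qed

text \<open>\<open>M14_A\<close> reads no \<open>Xs\<close> components. The rescaling in
  \<open>theta\<close> supplies the factors \<open>phi'\<close>; a tilt such as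
  \<open>- (1/2) * S11 p\<close> in \<open>Yc 3 2\<close> contributes through both products of
  \<open>wedge_sym\<close>, which add up to the full \<open>S11\<close> term.\<close>

lemma A_theta: "M14_A (theta p x) (theta p y) (theta p z) (theta p w) = curv p x y z w"
  unfolding M14_A_eq A_list_def list.map sum_list.Cons sum_list.Nil prod.case curv_def
    wedge_sym_def wedge_def theta_def vector_add_component vert_nth theta_eval
  by algebra

lemma has_0_model: "has_0_model (g_Phi \<phi>) M14_inner M14_A"
  unfolding has_0_model_def
proof (intro allI exI conjI)
  fix p
  show "linear (theta p)" by (rule linear_theta)
  \<comment> \<open>A map that preserves a nondegenerate form is injective; equal dimensions then
    give bijectivity.\<close>
  have "u = 0" if "theta p u = 0" for u
  proof (rule metric_at_nondegenerate[where g = "g_Phi \<phi>" and p = p, OF g_Phi_invertible])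
    show "metric_at (g_Phi \<phi>) p u w = metric_at (g_Phi \<phi>) p 0 w" for w
      using inner_theta[of p u w] that by (simp add: M14_inner_eq metric_at_def)
  qed
  then have "inj (theta p)" using linear_injective_0[OF linear_theta] by blast
  then show "bij (theta p)"
    using linear_injective_imp_surjective[OF linear_theta] by (simp add: bij_def)
qed (simp_all add: inner_theta A_theta curv_tensor_eq)

end

theorem theorem1p6:
  fixes \<phi> :: "3 \<Rightarrow> 2 \<Rightarrow> real \<Rightarrow> real"
  assumes "\<And>i j. smooth (\<phi> i j)"
    and "\<And>i t. deriv (\<phi> i 1) t * deriv (\<phi> i 2) t = 1"
  shows "geodesically_complete (g_Phi \<phi>)
    \<and> (\<forall>P. exp_domain (g_Phi \<phi>) P = UNIV \<and> diffeomorphism (exp_map (g_Phi \<phi>) P))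
    \<and> has_0_model (g_Phi \<phi>) M14_inner M14_A
    \<and> jacobi_tsankov (g_Phi \<phi>) \<and> \<not> two_step_jacobi_nilpotent (g_Phi \<phi>)"
proof -
  interpret phi_family \<phi> by unfold_locales (fact assms)+
  show ?thesis
    using complete exp_diffeomorphism has_0_model jacobi_tsankov not_two_step_jacobi_nilpotent by blast
qed

end
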